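(* Let $d\ge 3$, $p\in[1/(2d),1]$, and let $S=(S_n)_{n\ge0}$ be a multi-dimensional elephant random walk on $\mathbb{Z}^d$ with memory parameter $p$. Then, almost surely, for all but finitely many $n>1$, $$\|S_n\|\ \ge\ n^{1/2}(\log n)^{-3}.$$
   Context: Multi-dimensional elephant random walk (MERW): let $e_1,\dots,e_d$ be the standard basis of $\mathbb{R}^d$ and $p\in[0,1]$. Set $S_0=0$ and $S_1=\sigma_1=e_1$. For each $n\ge 1$, choose $n'$ uniformly at random in $\{1,\dots,n\}$ (independently of the past); given the past and $n'$, let $\sigma_{n+1}=\sigma_{n'}$ with probability $p$, and $\sigma_{n+1}=\sigma$ with probability $\frac{1-p}{2d-1}$ for each $\sigma\in\{\pm e_1,\dots,\pm e_d\}\setminus\{\sigma_{n'}\}$. Set $S_{n+1}=S_n+\sigma_{n+1}$. The process $(S_n)_{n\ge0}$ is a MERW on $\mathbb{Z}^d$ with memory parameter $p$. $\|\cdot\|$ is the Euclidean norm. *)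

theory Defs
  imports "HOL-Probability.Probability"
begin

definition unit_steps :: "(real ^ 'd) set" where
  "unit_steps = (\<Union>i. {axis i 1, - axis i 1})"

text \<open>The sigma-algebra generated by the steps \<open>\<sigma> 1, \<dots>, \<sigma> m\<close> and the
  chosen times \<open>N 1, \<dots>, N n\<close>. All these variables take values in finite sets, so
  preimages of arbitrary sets are used as generators.\<close>

definition history ::
  "'w measure \<Rightarrow> (nat \<Rightarrow> 'w \<Rightarrow> real ^ 'd) \<Rightarrow> (nat \<Rightarrow> 'w \<Rightarrow> nat) \<Rightarrow> nat \<Rightarrow> nat \<Rightarrow> 'w measure" where
  "history M \<sigma> N m n =
     sigma (space M) ({\<sigma> k -` A \<inter> space M | k A. k \<in> {1..m}} \<union>
                      {N k -` A \<inter> space M | k A. k \<in> {1..n}})"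

text \<open>\<open>N n\<close> is the remembered time \<open>n'\<close> used to produce \<open>\<sigma> (Suc n)\<close>, so the past at
  the moment when \<open>N n\<close> is chosen is \<open>history M \<sigma> N n (n - 1)\<close>. The value \<open>\<sigma> 0\<close> and the
  value \<open>N 0\<close> play no role. The coordinates are indexed by the type \<open>'d\<close>; the index \<open>i\<^sub>1\<close> is
  the one of the first basis vector.\<close>

locale merw = prob_space M
  for M :: "'w measure"
    and i\<^sub>1 :: "'d::finite"
    and p :: real
    and \<sigma> :: "nat \<Rightarrow> 'w \<Rightarrow> real ^ 'd"
    and N :: "nat \<Rightarrow> 'w \<Rightarrow> nat"
    and S :: "nat \<Rightarrow> 'w \<Rightarrow> real ^ 'd" +
  assumes memory: "p \<in> {0..1}"
    and measurable_step: "n \<ge> 1 \<Longrightarrow> \<sigma> n \<in> measurable M (count_space unit_steps)"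
    and measurable_time: "n \<ge> 1 \<Longrightarrow> N n \<in> measurable M (count_space {1..n})"
    and first_step: "\<omega> \<in> space M \<Longrightarrow> \<sigma> 1 \<omega> = axis i\<^sub>1 1"
    and time_uniform:
      "n \<ge> 1 \<Longrightarrow> distr M (count_space {1..n}) (N n) = uniform_count_measure {1..n}"
    and time_indep:
      "n \<ge> 1 \<Longrightarrow> indep_set (sets (history M \<sigma> N n (n - 1))) {N n -` A \<inter> space M | A. True}"
    and step_conditional:
      "n \<ge> 1 \<Longrightarrow> x \<in> unit_steps \<Longrightarrow>
         AE \<omega> in M. real_cond_exp M (history M \<sigma> N n n)
                       (indicator {\<omega> \<in> space M. \<sigma> (Suc n) \<omega> = x}) \<omega>
           = (if x = \<sigma> (N n \<omega>) \<omega> then p else (1 - p) / (2 * real CARD('d) - 1))"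
    and walk_0: "\<omega> \<in> space M \<Longrightarrow> S 0 \<omega> = 0"
    and walk_Suc: "\<omega> \<in> space M \<Longrightarrow> S (Suc n) \<omega> = S n \<omega> + \<sigma> (Suc n) \<omega>"

end

theory Submission
  imports Defs "HOL-Real_Asymp.Real_Asymp"
begin

text \<open>
  Put \<open>q = (1 - p) / (2 d - 1)\<close> and \<open>a = p - q\<close>. Given the past, the next step is with weight
  \<open>a\<close> a copy of a uniformly chosen earlier step and with weight \<open>2 d q\<close> uniform on the \<open>2 d\<close>
  unit steps; \<open>p \<ge> 1 / (2 d)\<close> means \<open>a \<ge> 0\<close>. For \<open>p = 1\<close> all steps are equal almost surely. Let
  \<open>p < 1\<close>, so that \<open>a < 1\<close>.

  The proof is a Lyapunov argument with \<open>f x = (|x|\<^sup>2 + K) powr (-1/4)\<close>. The conditional drift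
  \<open>a S\<^sub>n / n\<close> points away from the origin and can only decrease \<open>f\<close>. The second order
  term involves the second moments of the step, a diagonal matrix with the conditional probabilities
  of the axes as its entries. If all of them are at most \<open>3/8\<close>, the trace of the Hessian of \<open>f\<close>
  against this matrix is at most \<open>- (1 - 5/2 * 3/8) f / (2 |x|\<^sup>2)\<close> to leading order, and so the
  conditional mean of \<open>f (S (Suc n))\<close> is at most \<open>f (S n) - f (S n) ^ 5 / 200\<close> once \<open>K\<close> is large
  (\<open>step_mean_lyap_le\<close>). For balanced axes these probabilities are close to \<open>1 / d\<close>, and
  \<open>1 / d < 3/8\<close> is where \<open>d \<ge> 3\<close> enters.

  The axes do become balanced: the number of steps along an axis, centred by \<open>n / d\<close>, is
  multiplied by \<open>1 + a / n\<close> in conditional mean at each step, and so its second moment is at most of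
  order \<open>n powr (1 + a)\<close>. Its square divided by \<open>n\<^sup>2\<close>, plus \<open>1 / n\<close>, is a supermartingale
  with mean tending to \<open>0\<close>, and the maximal inequality shows that the probability of an unbalanced time from \<open>n\<close>
  on tends to \<open>0\<close> (\<open>prob_unbalanced_tendsto_0\<close>).

  Stop \<open>f (S m)\<close>, by setting it to \<open>0\<close>, at the first unbalanced time from \<open>n\<close> on. By Jensen, the
  means \<open>x m\<close> satisfy \<open>x (Suc m) \<le> x m - x m ^ 5 / 200\<close>, hence are of order \<open>m powr (-1/4)\<close>
  (\<open>prob_stopped_lyap_ge\<close>). A visit at a time \<open>m\<close> of order \<open>2 ^ j\<close> to the ball of radius
  \<open>m powr (1/2) * ln m powr (-3)\<close> makes \<open>f\<close> as large as \<open>2 powr (-j/4) * j powr (3/2)\<close> up to a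
  constant, and the maximal inequality from time \<open>2 ^ j\<close> on bounds the probability of such a visit
  by a multiple of \<open>j powr (-3/2)\<close>. This is summable, so the Borel-Cantelli lemma concludes.
\<close>

section \<open>Unit steps and the mean of the next step\<close>

lemma sum_unit_steps:
  fixes h :: "real ^ 'd::finite \<Rightarrow> real"
  shows "sum h unit_steps = (\<Sum>i\<in>UNIV. h (axis i 1) + h (- axis i 1))"
proof -
  have ne: "axis i (1::real) \<noteq> - axis j 1" for i j :: 'd
  proof
    assume "axis i (1::real) = - axis j 1"
    then have "axis i (1::real) $ i = - axis j 1 $ i" by simp
    then show False by (simp add: axis_def split: if_splits)
  qed
  have "sum h unit_steps = (\<Sum>i\<in>UNIV. sum h {axis i 1, - axis i 1})"
    unfolding unit_steps_def using ne ne[THEN not_sym]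
    by (subst sum.UNION_disjoint) (auto simp: axis_eq_axis)
  then show ?thesis using ne by simp
qed

lemma finite_unit_steps [simp]: "finite (unit_steps :: (real ^ 'd::finite) set)"
  by (simp add: unit_steps_def)

lemma unit_step_cases:
  assumes "u \<in> unit_steps"
  obtains i where "u = axis i 1" | i where "u = - axis i 1"
  using assms by (auto simp: unit_steps_def)

lemma norm_unit_step: "u \<in> unit_steps \<Longrightarrow> norm u = 1"
  by (auto elim!: unit_step_cases)

lemma unit_step_component_sq:
  "u \<in> unit_steps \<Longrightarrow> (u $ i)\<^sup>2 \<in> {0, 1}"
  by (auto elim!: unit_step_cases simp: axis_def)

lemma sum_if_eq:
  fixes c :: "'d::finite \<Rightarrow> real"
  shows "(\<Sum>i\<in>UNIV. (if i = j then 1 else 0) * c i) = c j"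
  by (simp add: if_distrib[of "\<lambda>x. x * _"] cong: if_cong)

text \<open>A unit step has a single nonzero coordinate, so there are no mixed products. This is what makes
  the matrix of second moments of the next step diagonal.\<close>
lemma unit_step_inner_sq:
  fixes u y :: "real ^ 'd::finite"
  assumes "u \<in> unit_steps"
  shows "(u \<bullet> y)\<^sup>2 = (\<Sum>i\<in>UNIV. (u $ i)\<^sup>2 * (y $ i)\<^sup>2)"
proof -
  have sq: "(axis j (1::real) $ i)\<^sup>2 = (if i = j then 1 else 0)" for i j :: 'd
    by (simp add: axis_def)
  show ?thesis
    using assms by (elim unit_step_cases) (simp_all add: inner_axis' sq sum_if_eq)
qed

text \<open>The conditional expectation of \<open>h\<close> at step \<open>Suc n\<close> when the first \<open>n\<close> steps are
  \<open>u 1, \<dots>, u n\<close>. The probability \<open>p\<close> of repeating the remembered step is split into \<open>q\<close>, which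
  completes the uniform part, and the surplus \<open>p - q\<close>, which makes the formula linear in the
  empirical distribution of the past.\<close>
definition step_mean :: "real \<Rightarrow> (nat \<Rightarrow> real ^ 'd::finite) \<Rightarrow> nat \<Rightarrow> (real ^ 'd \<Rightarrow> real) \<Rightarrow> real" where
  "step_mean p u n h =
     (let q = (1 - p) / (2 * real CARD('d) - 1)
      in (p - q) / n * (\<Sum>k = 1..n. h (u k)) + q * (\<Sum>x\<in>unit_steps. h x))"

text \<open>A fixed past in the range \<open>p \<ge> 1 / (2 d)\<close>, where the surplus \<open>p - q\<close> is nonnegative and the
  averaging operator is therefore monotone.\<close>
locale step_history =
  fixes p :: real and u :: "nat \<Rightarrow> real ^ 'd::finite" and n :: nat
  assumes p_le: "p \<le> 1" and p_ge: "p \<ge> 1 / (2 * real CARD('d))" and n_pos: "n \<ge> 1"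
    and steps: "k \<in> {1..n} \<Longrightarrow> u k \<in> unit_steps"
begin

definition q where "q = (1 - p) / (2 * real CARD('d) - 1)"

lemma denominator_pos: "2 * real CARD('d) - 1 > 0"
proof -
  have "CARD('d) \<ge> 1" by (simp add: Suc_leI)
  then show ?thesis by linarith
qed

lemma q_nonneg: "q \<ge> 0"
  unfolding q_def using p_le denominator_pos by (intro divide_nonneg_pos) auto

lemma q_times_denominator: "q * (2 * real CARD('d) - 1) = 1 - p"
  using denominator_pos by (simp add: q_def)

lemma total_mass: "(p - q) + q * (2 * real CARD('d)) = 1"
  using q_times_denominator by (simp add: algebra_simps)

lemma p_ge_q: "p - q \<ge> 0"
proof -
  have C: "2 * real CARD('d) > 0" using denominator_pos by linarith
  have "2 * real CARD('d) * q = 1 - (p - q)" using total_mass by (simp add: algebra_simps)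
  moreover have "1 \<le> 2 * real CARD('d) * p" using p_ge C by (simp add: divide_le_eq mult.commute)
  ultimately have "0 \<le> (2 * real CARD('d) - 1) * (p - q)" by (simp add: algebra_simps)
  then show ?thesis using denominator_pos by (simp add: zero_le_mult_iff)
qed

lemma step_mean_eq: "step_mean p u n h = (p - q) / n * (\<Sum>k = 1..n. h (u k)) + q * (\<Sum>x\<in>unit_steps. h x)"
  by (simp add: step_mean_def q_def Let_def)

lemma step_mean_mono:
  assumes "\<And>x. x \<in> unit_steps \<Longrightarrow> h x \<le> g x"
  shows "step_mean p u n h \<le> step_mean p u n g"
  unfolding step_mean_eq using assms steps q_nonneg p_ge_q
  by (intro add_mono mult_left_mono sum_mono) auto

lemma step_mean_add: "step_mean p u n (\<lambda>x. h x + g x) = step_mean p u n h + step_mean p u n g"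
  unfolding step_mean_eq by (simp add: sum.distrib algebra_simps)

lemma step_mean_cmult: "step_mean p u n (\<lambda>x. c * h x) = c * step_mean p u n h"
  unfolding step_mean_eq sum_distrib_left[symmetric] by (simp only: distrib_left mult_ac)

lemma step_mean_const: "step_mean p u n (\<lambda>x. c) = c"
proof -
  have "(\<Sum>x\<in>(unit_steps :: (real ^ 'd) set). c) = 2 * real CARD('d) * c"
    unfolding sum_unit_steps by simp
  then have "step_mean p u n (\<lambda>x. c) = (p - q) / n * (n * c) + q * (2 * real CARD('d) * c)"
    unfolding step_mean_eq by simp
  also have "\<dots> = ((p - q) + q * (2 * real CARD('d))) * c"
    using n_pos by (simp add: distrib_right)
  finally have "step_mean p u n (\<lambda>x. c) = ((p - q) + q * (2 * real CARD('d))) * c" .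
  then show ?thesis by (simp only: total_mass)
qed

lemma step_mean_sum: "step_mean p u n (\<lambda>x. \<Sum>i\<in>A. h i x) = (\<Sum>i\<in>A. step_mean p u n (h i))"
proof (induction A rule: infinite_finite_induct)
  case (insert i A)
  then show ?case by (simp add: step_mean_add)
qed (simp_all add: step_mean_const)

lemma step_mean_inner: "step_mean p u n (\<lambda>x. x \<bullet> y) = (p - q) / n * ((\<Sum>k = 1..n. u k) \<bullet> y)"
  unfolding step_mean_eq by (simp add: sum_unit_steps inner_sum_left)

lemma step_mean_component_sq:
  "step_mean p u n (\<lambda>x. (x $ i)\<^sup>2) = (p - q) / n * (\<Sum>k = 1..n. (u k $ i)\<^sup>2) + 2 * q"
proof -
  have "(\<Sum>x\<in>unit_steps. (x $ i)\<^sup>2) = (\<Sum>j\<in>UNIV. (if j = i then 1 else 0) * 2)"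
    unfolding sum_unit_steps by (intro sum.cong) (auto simp: axis_def)
  also have "\<dots> = 2" by (rule sum_if_eq)
  finally show ?thesis unfolding step_mean_eq by simp
qed

text \<open>The quadratic form of the second moments has the probability of axis \<open>i\<close> as its \<open>i\<close>-th
  diagonal entry. The bound \<open>3/8\<close> holds for the copied part by balance and for the uniform part
  because \<open>1 / d \<le> 1/3 \<le> 3/8\<close>.\<close>
lemma step_mean_inner_sq_le:
  assumes d: "CARD('d) \<ge> 3"
    and balanced: "\<And>i. (\<Sum>k = 1..n. (u k $ i)\<^sup>2) \<le> 3 / 8 * n"
  shows "step_mean p u n (\<lambda>x. (x \<bullet> y)\<^sup>2) \<le> 3 / 8 * (norm y)\<^sup>2"
proof -
  have "real CARD('d) \<ge> 3" using d by linarith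
  then have "q * 6 \<le> q * (2 * real CARD('d))" using q_nonneg by (intro mult_left_mono) auto
  then have q: "6 * q \<le> 1 - (p - q)" using total_mass by linarith
  have coord: "step_mean p u n (\<lambda>x. (x $ i)\<^sup>2) \<le> 3 / 8" for i
  proof -
    have "(p - q) / n * (\<Sum>k = 1..n. (u k $ i)\<^sup>2) \<le> (p - q) / n * (3 / 8 * n)"
      using balanced p_ge_q by (intro mult_left_mono) auto
    also have "(p - q) / n * (3 / 8 * n) = 3 / 8 * (p - q)" using n_pos by simp
    finally show ?thesis
      unfolding step_mean_component_sq using q q_nonneg by argo
  qed
  have "step_mean p u n (\<lambda>x. (x \<bullet> y)\<^sup>2) \<le> step_mean p u n (\<lambda>x. \<Sum>i\<in>UNIV. (y $ i)\<^sup>2 * (x $ i)\<^sup>2)"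
    by (intro step_mean_mono) (simp add: unit_step_inner_sq mult.commute)
  also have "\<dots> = (\<Sum>i\<in>UNIV. (y $ i)\<^sup>2 * step_mean p u n (\<lambda>x. (x $ i)\<^sup>2))"
    by (simp add: step_mean_sum step_mean_cmult)
  also have "\<dots> \<le> (\<Sum>i\<in>UNIV. (y $ i)\<^sup>2 * (3 / 8))"
    using coord by (intro sum_mono mult_left_mono) auto
  also have "\<dots> = 3 / 8 * (norm y)\<^sup>2"
    unfolding power2_norm_eq_inner inner_vec_def
    by (simp only: power2_eq_square inner_real_def mult.commute[of _ "3 / 8"] sum_distrib_left)
  finally show ?thesis .
qed

end

text \<open>The centred number \<open>Y\<close> of steps along an axis drifts by \<open>(p - q) Y / n\<close>, because the uniform
  part contributes exactly \<open>1 / d\<close> to the frequency of the axis. One step changes it by at most \<open>1\<close>.\<close>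
lemma (in step_history) step_mean_axis_deviation:
  fixes i :: 'd
  defines "Y \<equiv> (\<Sum>k = 1..n. (u k $ i)\<^sup>2) - n / CARD('d)"
  shows "step_mean p u n (\<lambda>x. (Y + (x $ i)\<^sup>2 - 1 / CARD('d))\<^sup>2) \<le> (1 + 2 * (p - q) / n) * Y\<^sup>2 + 1"
proof -
  define r where "r = 1 / real CARD('d)"
  have r: "0 \<le> r" "r \<le> 1" by (simp_all add: r_def divide_le_eq Suc_leI)
  have "2 * q = (q * (2 * real CARD('d))) * r" by (simp add: r_def)
  moreover have "q * (2 * real CARD('d)) = 1 - (p - q)" using total_mass by linarith
  ultimately have q2: "2 * q = (1 - (p - q)) * r" by simp
  have "step_mean p u n (\<lambda>x. (Y + (x $ i)\<^sup>2 - r)\<^sup>2)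
      \<le> step_mean p u n (\<lambda>x. (Y\<^sup>2 - 2 * Y * r + 1) + (2 * Y) * (x $ i)\<^sup>2)"
  proof (rule step_mean_mono)
    fix x :: "real ^ 'd" assume "x \<in> unit_steps"
    then have "\<bar>(x $ i)\<^sup>2 - r\<bar> \<le> 1"
      using unit_step_component_sq[of x i] r by auto
    then have "((x $ i)\<^sup>2 - r)\<^sup>2 \<le> 1" by (simp add: abs_square_le_1)
    moreover have "(Y + (x $ i)\<^sup>2 - r)\<^sup>2 = Y\<^sup>2 - 2 * Y * r + (2 * Y) * (x $ i)\<^sup>2 + ((x $ i)\<^sup>2 - r)\<^sup>2"
      by algebra
    ultimately show "(Y + (x $ i)\<^sup>2 - r)\<^sup>2 \<le> (Y\<^sup>2 - 2 * Y * r + 1) + (2 * Y) * (x $ i)\<^sup>2" by linarith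
  qed
  also have "\<dots> = (Y\<^sup>2 - 2 * Y * r + 1) + (2 * Y) * step_mean p u n (\<lambda>x. (x $ i)\<^sup>2)"
    by (simp only: step_mean_add step_mean_cmult step_mean_const)
  also have "step_mean p u n (\<lambda>x. (x $ i)\<^sup>2) = (p - q) / n * (Y + n * r) + 2 * q"
    by (simp add: step_mean_component_sq Y_def r_def)
  also have "\<dots> = (p - q) / n * Y + r"
    unfolding q2 using n_pos by (simp add: field_simps)
  also have "(Y\<^sup>2 - 2 * Y * r + 1) + (2 * Y) * ((p - q) / n * Y + r) = (1 + 2 * (p - q) / n) * Y\<^sup>2 + 1"
    by (simp add: algebra_simps power2_eq_square)
  finally show ?thesis by (simp add: r_def)
qed

section \<open>The Lyapunov function\<close>

text \<open>The Taylor polynomial has quadratic coefficient \<open>5/32\<close>; the slightly larger \<open>4/25\<close> absorbs the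
  remainder near \<open>0\<close>. It must stay below \<open>1/6\<close>: after averaging, the linear term gains \<open>1/4\<close> and
  the quadratic one costs at most \<open>4 * 3/8\<close> times this coefficient. The proof takes the square root
  twice, which keeps the polynomial inequalities of low degree.\<close>
lemma quarter_root_bound:
  fixes z :: real
  assumes "\<bar>z\<bar> \<le> 1 / 100"
  shows "(1 + z) powr (-1/4) \<le> 1 - z / 4 + 4 * z\<^sup>2 / 25"
proof -
  define w v s where "w = 1 - z / 4 + 4 * z\<^sup>2 / 25" and "v = 1 - z / 2 + 19 * z\<^sup>2 / 50"
    and "s = (1 + z) powr (-1/4)"
  have z: "-1/100 \<le> z" "z \<le> 1/100" using assms by (simp_all add: abs_le_iff)
  have z2: "0 \<le> z\<^sup>2" "z\<^sup>2 \<le> 1/10000" using power_mono[OF assms, of 2] by (simp_all add: power2_eq_square)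
  have "\<bar>z ^ 3\<bar> \<le> (1/100) ^ 3" using power_mono[OF assms, of 3] by (simp add: power_abs)
  then have z3: "- 1/1000000 \<le> z ^ 3" by (simp add: abs_le_iff power3_eq_cube)
  have pos: "w > 0" "v > 0" using z z2 unfolding w_def v_def by linarith+
  have "0 \<le> z\<^sup>2 * (1/100 + 63/100 * z - 589/2500 * z\<^sup>2 + 361/2500 * z ^ 3)"
    using z z2 z3 by (intro mult_nonneg_nonneg) linarith+
  also have "\<dots> = v\<^sup>2 * (1 + z) - 1" unfolding v_def by algebra
  finally have "1 / (1 + z) \<le> v\<^sup>2" using z by (simp add: divide_le_eq)
  also have "1 / (1 + z) = (s\<^sup>2)\<^sup>2"
  proof -
    have "s > 0" using z by (simp add: s_def)
    have "(s\<^sup>2)\<^sup>2 = s ^ 4" by (simp flip: power_mult)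
    also have "\<dots> = s powr (real 4)" using powr_realpow[OF \<open>s > 0\<close>, of 4] by simp
    also have "\<dots> = (1 + z) powr (-1)" unfolding s_def powr_powr by simp
    also have "\<dots> = 1 / (1 + z)" using z by (simp add: powr_minus_divide)
    finally show ?thesis ..
  qed
  finally have "s\<^sup>2 \<le> v" by (rule power2_le_imp_le) (use pos in simp)
  also have "v \<le> w\<^sup>2"
  proof -
    have "0 \<le> z\<^sup>2 * (1/400 - 2/25 * z + 16/625 * z\<^sup>2)"
    using z z2 by (intro mult_nonneg_nonneg) linarith+
    also have "\<dots> = w\<^sup>2 - v" unfolding w_def v_def by algebra
    finally show ?thesis by simp
  qed
  finally have "s \<le> w" by (rule power2_le_imp_le) (use pos in simp)
  then show ?thesis by (simp add: s_def w_def)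
qed

text \<open>The square of \<open>300\<close>: it keeps the relative change of \<open>|x|\<^sup>2 + offset\<close> in one step within the
  range \<open>1/100\<close> of the Taylor bound, at every \<open>x\<close>.\<close>
definition offset :: real where "offset = 90000"

text \<open>For \<open>d = 3\<close> a power \<open>|x| powr (-b)\<close> is superharmonic at large \<open>x\<close> when \<open>b \<le> 1\<close>, and the escape
  rate needs \<open>3 * b > 1\<close> to make \<open>j powr (-3 * b)\<close> summable. The choice \<open>b = 1/2\<close> leaves room on both
  sides.\<close>
definition lyap :: "'a::real_normed_vector \<Rightarrow> real" where
  "lyap x = ((norm x)\<^sup>2 + offset) powr (-1/4)"

lemma lyap_pos: "lyap x > 0"
  and lyap_le_1: "lyap x \<le> 1"
  and lyap_power_4: "lyap x ^ 4 = 1 / ((norm x)\<^sup>2 + offset)"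
proof -
  have s: "(norm x)\<^sup>2 + offset \<ge> 1" by (simp add: offset_def)
  then show "lyap x > 0" by (simp add: lyap_def)
  have "((norm x)\<^sup>2 + offset) powr (-1/4) \<le> ((norm x)\<^sup>2 + offset) powr 0"
    using s by (intro powr_mono) auto
  then show "lyap x \<le> 1" using s by (simp add: lyap_def)
  have "lyap x ^ 4 = lyap x powr (real 4)"
    using \<open>lyap x > 0\<close> by (simp add: powr_realpow)
  also have "\<dots> = ((norm x)\<^sup>2 + offset) powr (-1)" by (simp add: lyap_def powr_powr)
  also have "\<dots> = 1 / ((norm x)\<^sup>2 + offset)" using s by (simp add: powr_minus_divide)
  finally show "lyap x ^ 4 = 1 / ((norm x)\<^sup>2 + offset)" .
qed

text \<open>With \<open>s = |x|\<^sup>2 + offset\<close> the step \<open>v\<close> multiplies \<open>s\<close> by \<open>1 + z\<close>. Writing \<open>1 / s\<close> as a power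
  of \<open>lyap x\<close> makes the bound a polynomial in \<open>v \<bullet> x\<close> and \<open>lyap x\<close>, ready to be averaged.\<close>
lemma lyap_step_le:
  fixes x v :: "'a::real_inner"
  assumes "norm v = 1"
  defines "z \<equiv> (2 * (v \<bullet> x) + 1) * lyap x ^ 4"
  shows "lyap (x + v) \<le> lyap x * (1 - z / 4 + 4 * z\<^sup>2 / 25)"
proof -
  define s where "s = (norm x)\<^sup>2 + offset"
  have s: "s \<ge> 90000" by (simp add: s_def offset_def)
  have z: "z = (2 * (v \<bullet> x) + 1) / s" by (simp add: z_def lyap_power_4 s_def)
  have "v \<bullet> v = 1" using assms(1) by (simp add: norm_eq_1)
  then have "(norm (x + v))\<^sup>2 + offset = s + (2 * (v \<bullet> x) + 1)"
    by (simp add: power2_norm_eq_inner inner_add inner_commute s_def)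
  also have "\<dots> = s * (1 + z)" using s unfolding z by (simp only: distrib_left) simp
  finally have sq: "(norm (x + v))\<^sup>2 + offset = s * (1 + z)" .
  have "norm x \<le> sqrt s" by (rule real_le_rsqrt) (simp add: s_def offset_def)
  then have "\<bar>v \<bullet> x\<bar> \<le> sqrt s"
    using Cauchy_Schwarz_ineq2[of v x] assms by simp
  moreover have "300 \<le> sqrt s" by (rule real_le_rsqrt) (use s in simp)
  moreover have "\<bar>2 * (v \<bullet> x) + 1\<bar> \<le> 2 * \<bar>v \<bullet> x\<bar> + 1" by linarith
  ultimately have "\<bar>2 * (v \<bullet> x) + 1\<bar> \<le> 3 * sqrt s" by linarith
  also have "\<dots> \<le> (sqrt s / 100) * sqrt s"
    using \<open>300 \<le> sqrt s\<close> s by (intro mult_right_mono) auto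
  also have "\<dots> = s / 100" using s by simp
  finally have "\<bar>z\<bar> \<le> 1 / 100" using s by (simp add: z divide_le_eq)
  have "1 + z > 0" using \<open>\<bar>z\<bar> \<le> 1 / 100\<close> by auto
  have "lyap (x + v) = s powr (-1/4) * (1 + z) powr (-1/4)"
    using s \<open>1 + z > 0\<close> by (simp add: lyap_def sq powr_mult)
  also have "\<dots> \<le> s powr (-1/4) * (1 - z / 4 + 4 * z\<^sup>2 / 25)"
    by (intro mult_left_mono quarter_root_bound) (use \<open>\<bar>z\<bar> \<le> 1 / 100\<close> in auto)
  finally show ?thesis by (simp add: lyap_def s_def)
qed

text \<open>Averaging the Taylor bound, with \<open>r = 1 / (|x|\<^sup>2 + offset)\<close>: the drift \<open>b \<ge> 0\<close> has a negative
  coefficient, and the balance of the axes leaves \<open>- r / 4 + 6 / 25 * r = - r / 100\<close> at first order in \<open>r\<close>.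
  Half of it pays for the terms of order \<open>r\<^sup>2\<close>.\<close>
lemma (in step_history) step_mean_lyap_le:
  assumes d: "CARD('d) \<ge> 3"
    and balanced: "\<And>i. (\<Sum>k = 1..n. (u k $ i)\<^sup>2) \<le> 3 / 8 * n"
  defines "x \<equiv> \<Sum>k = 1..n. u k"
  shows "step_mean p u n (\<lambda>v. lyap (x + v)) \<le> lyap x - lyap x ^ 5 / 200"
proof -
  define c where "c = lyap x"
  define r where "r = c ^ 4"
  have c: "c > 0" by (simp add: c_def lyap_pos)
  have r_eq: "r = 1 / ((norm x)\<^sup>2 + offset)" by (simp add: r_def c_def lyap_power_4)
  have pos: "(norm x)\<^sup>2 + offset \<ge> 90000" by (simp add: offset_def)
  have r: "0 < r" using c by (simp add: r_def)
  have "r \<le> 1 / 90000" unfolding r_eq using pos by (intro divide_left_mono) auto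
  have xr: "(norm x)\<^sup>2 * r \<le> 1" unfolding r_eq by (simp add: offset_def divide_le_eq add_nonneg_pos not_less)
  define b where "b = step_mean p u n (\<lambda>v. v \<bullet> x)"
  define Q where "Q = step_mean p u n (\<lambda>v. (v \<bullet> x)\<^sup>2)"
  have b: "b \<ge> 0"
    unfolding b_def step_mean_inner x_def[symmetric] using p_ge_q by simp
  have "Q * r \<le> 3 / 8 * (norm x)\<^sup>2 * r"
    unfolding Q_def using r by (intro mult_right_mono step_mean_inner_sq_le[OF d balanced]) auto
  then have Q: "Q * r \<le> 3 / 8" using xr by linarith
  have "step_mean p u n (\<lambda>v. lyap (x + v))
      \<le> step_mean p u n (\<lambda>v. c * (1 - r / 4 + 4 / 25 * r\<^sup>2)
          + (c * r * (16 / 25 * r - 1 / 2) * (v \<bullet> x) + c * r * (16 / 25 * r) * (v \<bullet> x)\<^sup>2))"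
  proof (rule step_mean_mono)
    fix v :: "real ^ 'd" assume "v \<in> unit_steps"
    then have "lyap (x + v) \<le> c * (1 - (2 * (v \<bullet> x) + 1) * r / 4 + 4 * ((2 * (v \<bullet> x) + 1) * r)\<^sup>2 / 25)"
      using lyap_step_le[OF norm_unit_step, of v x] by (simp only: c_def r_def)
    also have "\<dots> = c * (1 - r / 4 + 4 / 25 * r\<^sup>2)
          + (c * r * (16 / 25 * r - 1 / 2) * (v \<bullet> x) + c * r * (16 / 25 * r) * (v \<bullet> x)\<^sup>2)"
      by algebra
    finally show "lyap (x + v) \<le> \<dots>" .
  qed
  also have "\<dots> = c * (1 - r / 4 + 4 / 25 * r\<^sup>2)
          + (c * r * (16 / 25 * r - 1 / 2) * b + c * r * (16 / 25 * r) * Q)"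
    by (simp only: step_mean_add step_mean_cmult step_mean_const b_def Q_def)
  also have "\<dots> = c * (1 - r / 4 + 4 / 25 * r\<^sup>2)
          + (c * r * b * (16 / 25 * r - 1 / 2) + c * r * (16 / 25) * (Q * r))"
    by (simp only: mult_ac)
  also have "\<dots> \<le> c * (1 - r / 4 + 4 / 25 * r\<^sup>2) + (0 + c * r * (16 / 25) * (3 / 8))"
  proof (intro add_mono order_refl)
    show "c * r * b * (16 / 25 * r - 1 / 2) \<le> 0"
      using b c r \<open>r \<le> 1 / 90000\<close> by (intro mult_nonneg_nonpos) auto
    show "c * r * (16 / 25) * (Q * r) \<le> c * r * (16 / 25) * (3 / 8)"
      using Q c r by (intro mult_left_mono) auto
  qed
  also have "\<dots> = c - c * r * (1 / 100 - 4 / 25 * r)" by algebra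
  also have "\<dots> \<le> c - c * r * (1 / 200)"
    using c r \<open>r \<le> 1 / 90000\<close> by (intro diff_mono mult_left_mono) auto
  also have "c * r * (1 / 200) = c ^ 5 / 200" by (simp add: r_def eval_nat_numeral)
  finally show ?thesis by (simp add: c_def)
qed

lemma lyap_ge:
  fixes x :: "'a::real_normed_vector"
  assumes "(norm x)\<^sup>2 + offset \<le> s"
  shows "s powr (-1/4) \<le> lyap x"
proof -
  have "(norm x)\<^sup>2 + offset > 0" by (simp add: offset_def add_nonneg_pos)
  then have "((norm x)\<^sup>2 + offset) powr (1/4) \<le> s powr (1/4)" "((norm x)\<^sup>2 + offset) powr (1/4) > 0"
    using assms by (auto intro!: powr_mono2)
  then show ?thesis unfolding lyap_def by (simp add: powr_minus le_imp_inverse_le)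
qed

section \<open>A maximal inequality and two recursions\<close>

lemma (in prob_space) integrable_bounded:
  fixes f :: "'a \<Rightarrow> real"
  assumes "f \<in> borel_measurable M" "\<And>\<omega>. \<omega> \<in> space M \<Longrightarrow> \<bar>f \<omega>\<bar> \<le> B"
  shows "integrable M f"
  using assms by (intro integrable_const_bound[of _ B]) auto

text \<open>Doob's maximal inequality for nonnegative supermartingales, with the supermartingale property
  in integrated form over the events of the past. It is proved by optional stopping: \<open>B m\<close> says that
  the level has not been reached up to time \<open>m\<close>, and \<open>l\<close> times the probability of having reached it
  plus the mean of \<open>U m\<close> on \<open>B m\<close> does not increase.\<close>
lemma (in prob_space) supermartingale_maximal_inequality:
  fixes U :: "nat \<Rightarrow> 'a \<Rightarrow> real" and F :: "nat \<Rightarrow> 'a measure"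
  assumes sub: "\<And>m. n \<le> m \<Longrightarrow> subalgebra M (F m)"
    and mono: "\<And>m. n \<le> m \<Longrightarrow> sets (F m) \<subseteq> sets (F (Suc m))"
    and adapted: "\<And>m. n \<le> m \<Longrightarrow> U m \<in> borel_measurable (F m)"
    and nonneg: "\<And>m \<omega>. n \<le> m \<Longrightarrow> \<omega> \<in> space M \<Longrightarrow> 0 \<le> U m \<omega>"
    and integrable: "\<And>m. n \<le> m \<Longrightarrow> integrable M (U m)"
    and step: "\<And>m A. n \<le> m \<Longrightarrow> A \<in> sets (F m) \<Longrightarrow>
        (\<integral>\<omega>. indicator A \<omega> * U (Suc m) \<omega> \<partial>M) \<le> (\<integral>\<omega>. indicator A \<omega> * U m \<omega> \<partial>M)"
    and "l > 0"
  shows "prob {\<omega> \<in> space M. \<exists>m\<ge>n. l \<le> U m \<omega>} \<le> expectation (U n) / l"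
proof -
  define B where "B m = {\<omega> \<in> space M. \<forall>k\<in>{n..m}. U k \<omega> < l}" for m
  define H where "H m = {\<omega> \<in> space M. \<exists>k\<in>{n..m}. l \<le> U k \<omega>}" for m
  have mono_le: "sets (F k) \<subseteq> sets (F m)" if "n \<le> k" "k \<le> m" for k m
    using that(2)
  proof (induction m rule: dec_induct)
    case (step m)
    then show ?case using mono[of m] that(1) by auto
  qed simp
  have spF: "space (F m) = space M" if "n \<le> m" for m
    using sub[OF that] by (simp add: subalgebra_def)
  have meas: "U k \<in> borel_measurable (F m)" if "n \<le> k" "k \<le> m" for k m
    using adapted[OF that(1)] mono_le[OF that] spF[of k] spF[of m] that
    by (auto simp: measurable_def)
  have BF: "B m \<in> sets (F m)" if "n \<le> m" for m
  proof -
    have "B m = {\<omega> \<in> space (F m). \<forall>k\<in>{n..m}. U k \<omega> < l}" using that by (simp add: B_def spF)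
    also have "\<dots> \<in> sets (F m)"
    proof (rule sets.sets_Collect_finite_All')
      fix k assume "k \<in> {n..m}"
      then have [measurable]: "U k \<in> borel_measurable (F m)" by (intro meas) auto
      show "{\<omega> \<in> space (F m). U k \<omega> < l} \<in> sets (F m)" by measurable
    qed (use that in auto)
    finally show ?thesis .
  qed
  have BM: "B m \<in> events" if "n \<le> m" for m
    using BF[OF that] sub[OF that] by (auto simp: subalgebra_def)
  have H_eq: "H m = space M - B m" for m by (auto simp: B_def H_def not_less)
  have HM: "H m \<in> events" if "n \<le> m" for m using BM[OF that] by (simp add: H_eq)
  have int: "integrable M (\<lambda>\<omega>. indicator A \<omega> * U k \<omega>)" if "A \<in> events" "n \<le> k" for A k
    using integrable_mult_indicator[OF that(1) integrable[OF that(2)]] by simp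
  have split: "expectation (\<lambda>\<omega>. indicator (B m) \<omega> * U k \<omega> + l * indicator (H m) \<omega>)
      = expectation (\<lambda>\<omega>. indicator (B m) \<omega> * U k \<omega>) + l * prob (H m)"
    and int_split: "integrable M (\<lambda>\<omega>. indicator (B m) \<omega> * U k \<omega> + l * indicator (H m) \<omega>)"
    if "n \<le> m" "n \<le> k" for m k
  proof -
    have H: "integrable M (\<lambda>\<omega>. l * indicator (H m) \<omega>)"
      using HM[OF that(1)]
      by (intro integrable_mult_right) (auto intro!: integrable_real_indicator simp: less_top[symmetric])
    show "expectation (\<lambda>\<omega>. indicator (B m) \<omega> * U k \<omega> + l * indicator (H m) \<omega>)
      = expectation (\<lambda>\<omega>. indicator (B m) \<omega> * U k \<omega>) + l * prob (H m)"
      using int[OF BM[OF that(1)] that(2)] H HM[OF that(1)] by simp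
    show "integrable M (\<lambda>\<omega>. indicator (B m) \<omega> * U k \<omega> + l * indicator (H m) \<omega>)"
      using int[OF BM[OF that(1)] that(2)] H by simp
  qed
  have key: "expectation (\<lambda>\<omega>. indicator (B m) \<omega> * U m \<omega>) + l * prob (H m) \<le> expectation (U n)"
    if "n \<le> m" for m
    using that
  proof (induction m rule: dec_induct)
    case base
    have "expectation (\<lambda>\<omega>. indicator (B n) \<omega> * U n \<omega>) + l * prob (H n)
        = expectation (\<lambda>\<omega>. indicator (B n) \<omega> * U n \<omega> + l * indicator (H n) \<omega>)"
      by (simp add: split)
    also have "\<dots> \<le> expectation (U n)"
      using int_split[of n n] integrable nonneg
      by (intro integral_mono) (auto simp: B_def H_def indicator_def)
    finally show ?case .
  next
    case (step m)
    have Sm: "n \<le> Suc m" using step by simp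
    have "expectation (\<lambda>\<omega>. indicator (B (Suc m)) \<omega> * U (Suc m) \<omega>) + l * prob (H (Suc m))
        = expectation (\<lambda>\<omega>. indicator (B (Suc m)) \<omega> * U (Suc m) \<omega> + l * indicator (H (Suc m)) \<omega>)"
      using Sm by (simp add: split)
    also have "\<dots> \<le> expectation (\<lambda>\<omega>. indicator (B m) \<omega> * U (Suc m) \<omega> + l * indicator (H m) \<omega>)"
    proof (rule integral_mono)
      fix \<omega> assume w: "\<omega> \<in> space M"
      have "{n..Suc m} = insert (Suc m) {n..m}" using Sm by auto
      then show "indicator (B (Suc m)) \<omega> * U (Suc m) \<omega> + l * indicator (H (Suc m)) \<omega>
          \<le> indicator (B m) \<omega> * U (Suc m) \<omega> + l * indicator (H m) \<omega>"
        using w nonneg[OF Sm w] \<open>l > 0\<close> by (auto simp: B_def H_def indicator_def not_less)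
    qed (use int_split Sm step in auto)
    also have "\<dots> = expectation (\<lambda>\<omega>. indicator (B m) \<omega> * U (Suc m) \<omega>) + l * prob (H m)"
      using Sm step by (simp add: split)
    also have "\<dots> \<le> expectation (\<lambda>\<omega>. indicator (B m) \<omega> * U m \<omega>) + l * prob (H m)"
      using assms(6)[OF \<open>n \<le> m\<close> BF[OF \<open>n \<le> m\<close>]] by simp
    also have "\<dots> \<le> expectation (U n)" by (rule step.IH)
    finally show ?case .
  qed
  have bound: "prob (H m) \<le> expectation (U n) / l" if "n \<le> m" for m
  proof -
    have "0 \<le> expectation (\<lambda>\<omega>. indicator (B m) \<omega> * U m \<omega>)"
      using nonneg that by (intro integral_nonneg_AE) auto
    then show ?thesis using key[OF that] \<open>l > 0\<close> by (simp add: field_simps)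
  qed
  have "(\<lambda>i. prob (H (n + i))) \<longlonglongrightarrow> prob (\<Union>i. H (n + i))"
  proof (rule finite_Lim_measure_incseq)
    show "range (\<lambda>i. H (n + i)) \<subseteq> events" using HM by auto
    show "incseq (\<lambda>i. H (n + i))" by (fastforce simp: incseq_def H_def)
  qed
  moreover have "(\<Union>i. H (n + i)) = {\<omega> \<in> space M. \<exists>m\<ge>n. l \<le> U m \<omega>}"
  proof (intro set_eqI iffI)
    fix \<omega> assume "\<omega> \<in> {\<omega> \<in> space M. \<exists>m\<ge>n. l \<le> U m \<omega>}"
    then obtain m where "\<omega> \<in> space M" "n \<le> m" "l \<le> U m \<omega>" by auto
    then have "\<omega> \<in> H (n + (m - n))" unfolding H_def by auto
    then show "\<omega> \<in> (\<Union>i. H (n + i))" by blast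
  qed (auto simp: H_def)
  ultimately show ?thesis
    using bound by (intro LIMSEQ_le_const2[of "\<lambda>i. prob (H (n + i))"]) auto
qed

text \<open>Jensen's inequality for the fifth power, from its tangent at the mean. The power is convex only
  on the nonnegative half line, and \<open>U\<close> may vanish, at the boundary of that half line.\<close>
lemma (in prob_space) expectation_power_5_ge:
  fixes U :: "'a \<Rightarrow> real"
  assumes [measurable]: "random_variable borel U"
    and U: "\<And>\<omega>. \<omega> \<in> space M \<Longrightarrow> 0 \<le> U \<omega> \<and> U \<omega> \<le> 1"
  shows "expectation U ^ 5 \<le> expectation (\<lambda>\<omega>. U \<omega> ^ 5)"
proof -
  define y where "y = expectation U"
  have "y \<ge> 0" using U by (auto simp: y_def intro!: integral_nonneg_AE)
  have int: "integrable M U" "integrable M (\<lambda>\<omega>. U \<omega> ^ 5)"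
    using U by (auto intro!: integrable_const_bound[of _ 1] simp: power_le_one)
  have "expectation (\<lambda>\<omega>. 5 * y ^ 4 * U \<omega> - 4 * y ^ 5) \<le> expectation (\<lambda>\<omega>. U \<omega> ^ 5)"
  proof (rule integral_mono)
    fix \<omega> assume "\<omega> \<in> space M"
    define v where "v = U \<omega>"
    have "v \<ge> 0" using U \<open>\<omega> \<in> space M\<close> by (simp add: v_def)
    then have "0 \<le> (v - y)\<^sup>2 * (v ^ 3 + 2 * y * v ^ 2 + 3 * y ^ 2 * v + 4 * y ^ 3)"
      using \<open>y \<ge> 0\<close> by (intro mult_nonneg_nonneg add_nonneg_nonneg) auto
    also have "\<dots> = v ^ 5 - (5 * y ^ 4 * v - 4 * y ^ 5)" by algebra
    finally show "5 * y ^ 4 * U \<omega> - 4 * y ^ 5 \<le> U \<omega> ^ 5" by (simp add: v_def)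
  qed (use int in auto)
  also have "expectation (\<lambda>\<omega>. 5 * y ^ 4 * U \<omega> - 4 * y ^ 5) = 5 * y ^ 4 * y - 4 * y ^ 5"
    using int by (simp add: y_def prob_space)
  also have "\<dots> = y ^ 5" by (simp add: eval_nat_numeral)
  finally show ?thesis by (simp add: y_def)
qed

text \<open>The discrete analogue of \<open>x' = - c x ^ 5\<close>, whose solutions satisfy \<open>x ^ 4 \<le> 1 / (4 c t)\<close>. With
  \<open>t = c * x m ^ 4\<close>, the induction step is \<open>t (1 - t) (k + 1) \<le> (1 - t) (1 + t) \<le> 1\<close> from \<open>t k \<le> 1\<close>.\<close>
lemma fifth_power_decay:
  fixes x :: "nat \<Rightarrow> real"
  assumes "\<And>m. n \<le> m \<Longrightarrow> 0 \<le> x m" "\<And>m. n \<le> m \<Longrightarrow> x (Suc m) \<le> x m - c * x m ^ 5"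
    and "c > 0" "n \<le> m"
  shows "c * x m ^ 4 * real (m - n) \<le> 1"
  using \<open>n \<le> m\<close>
proof (induction m rule: dec_induct)
  case base
  then show ?case by simp
next
  case (step m)
  define t where "t = c * x m ^ 4"
  have xm: "0 \<le> x m" and xS: "0 \<le> x (Suc m)" using assms(1) step by auto
  have t0: "t \<ge> 0" using \<open>c > 0\<close> by (simp add: t_def)
  have le: "x (Suc m) \<le> x m * (1 - t)"
    using assms(2)[of m] step by (simp add: t_def algebra_simps eval_nat_numeral)
  show ?case
  proof (cases "x m = 0 \<or> t > 1")
    case True
    then have "x (Suc m) = 0"
    proof
      assume "x m = 0" with le xS show ?thesis by simp
    next
      assume "t > 1"
      then have "x m * (1 - t) \<le> 0" using xm by (simp add: mult_le_0_iff)
      with le xS show ?thesis by simp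
    qed
    then show ?thesis by simp
  next
    case False
    then have t1: "t \<le> 1" by simp
    have "x (Suc m) ^ 4 \<le> (x m * (1 - t)) ^ 4" using le xS by (intro power_mono) auto
    also have "\<dots> \<le> x m ^ 4 * (1 - t)"
      unfolding power_mult_distrib
      using power_decreasing[of 1 4 "1 - t"] t0 t1 by (intro mult_left_mono) auto
    finally have "c * x (Suc m) ^ 4 \<le> t * (1 - t)" using \<open>c > 0\<close> by (simp add: t_def)
    then have "c * x (Suc m) ^ 4 * real (Suc m - n) \<le> t * (1 - t) * real (Suc m - n)"
      by (intro mult_right_mono) auto
    also have "\<dots> = (1 - t) * (t * real (m - n) + t)"
      using step by (simp add: Suc_diff_le algebra_simps)
    also have "\<dots> \<le> (1 - t) * (1 + t)"
      using step t1 by (intro mult_left_mono) (auto simp: t_def)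
    also have "\<dots> \<le> 1" by (simp add: algebra_simps)
    finally show ?thesis .
  qed
qed

lemma powr_bernoulli:
  fixes b x :: real
  assumes "1 \<le> b" "0 \<le> x"
  shows "1 + b * x \<le> (1 + x) powr b"
proof -
  define g where "g y = (1 + y) powr b - b * y" for y :: real
  have "g 0 \<le> g x"
  proof (rule DERIV_nonneg_imp_nondecreasing[OF \<open>0 \<le> x\<close>])
    fix y :: real assume "0 \<le> y" "y \<le> x"
    then have "(g has_real_derivative b * (1 + y) powr (b - 1) - b) (at y)"
      unfolding g_def by (auto intro!: derivative_eq_intros)
    moreover have "1 \<le> (1 + y) powr (b - 1)"
      using \<open>0 \<le> y\<close> assms by (intro ge_one_powr_ge_zero) auto
    ultimately show "\<exists>d. (g has_real_derivative d) (at y) \<and> 0 \<le> d"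
      using assms by (intro exI[of _ "b * (1 + y) powr (b - 1) - b"]) (auto simp: mult_le_cancel_left1)
  qed
  then show ?thesis by (simp add: g_def)
qed

text \<open>The exponent \<open>1 + a\<close> lies strictly between the growth rate \<open>2 a\<close> of the recursion and \<open>2\<close>. The
  first leaves room for the additive constant and the second makes \<open>v n / n\<^sup>2\<close> vanish.\<close>
lemma second_moment_growth:
  fixes v :: "nat \<Rightarrow> real"
  assumes "v 1 \<le> 1" "\<And>n. n \<ge> 1 \<Longrightarrow> v (Suc n) \<le> (1 + 2 * a / n) * v n + 1"
    and "0 \<le> a" "a < 1" "n \<ge> 1"
  shows "v n \<le> n powr (1 + a) / (1 - a)"
  using \<open>n \<ge> 1\<close>
proof (induction n rule: dec_induct)
  case base
  have "1 \<le> 1 / (1 - a)" using assms by simp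
  then show ?case using assms(1) by simp
next
  case (step n)
  define C where "C = 1 / (1 - a)"
  have C: "C > 0" "(1 - a) * C = 1" using assms by (auto simp: C_def)
  have "1 \<le> n powr a" using step assms by (intro ge_one_powr_ge_zero) auto
  have "v (Suc n) \<le> (1 + 2 * a / n) * v n + 1" using assms(2) step by simp
  also have "\<dots> \<le> (1 + 2 * a / n) * (C * n powr (1 + a)) + (1 - a) * C * n powr a"
    using step assms \<open>1 \<le> n powr a\<close>
    by (intro add_mono mult_left_mono) (auto simp: C_def)
  also have "\<dots> = C * (n powr (1 + a) * (1 + (1 + a) * (1 / n)))"
    using step by (simp add: powr_add field_simps)
  also have "\<dots> \<le> C * (n powr (1 + a) * (1 + 1 / n) powr (1 + a))"
    using C assms powr_bernoulli[of "1 + a" "1 / n"] by (intro mult_left_mono) auto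
  also have "n powr (1 + a) * (1 + 1 / n) powr (1 + a) = (n * (1 + 1 / n)) powr (1 + a)"
    using step by (simp add: powr_mult)
  also have "real n * (1 + 1 / n) = Suc n" using step by (simp add: field_simps)
  finally show ?case by (simp add: C_def)
qed

section \<open>The law of the next step given the past\<close>

context merw
begin

text \<open>The information available before the remembered time \<open>N n\<close> is drawn. It contains the first \<open>n\<close> steps
  but only the times \<open>N 1, \<dots>, N (n - 1)\<close>.\<close>
abbreviation past :: "nat \<Rightarrow> 'w measure" where
  "past n \<equiv> history M \<sigma> N n (n - 1)"

lemma step_in_unit_steps: "\<omega> \<in> space M \<Longrightarrow> n \<ge> 1 \<Longrightarrow> \<sigma> n \<omega> \<in> unit_steps"
  using measurable_space[OF measurable_step] by simp

lemma time_in_range: "\<omega> \<in> space M \<Longrightarrow> n \<ge> 1 \<Longrightarrow> N n \<omega> \<in> {1..n}"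
  using measurable_space[OF measurable_time] by simp

lemma step_event: "k \<ge> 1 \<Longrightarrow> \<sigma> k -` A \<inter> space M \<in> events"
proof -
  assume k: "k \<ge> 1"
  have "\<sigma> k -` (A \<inter> unit_steps) \<inter> space M \<in> events"
    by (rule measurable_sets[OF measurable_step[OF k]]) auto
  also have "\<sigma> k -` (A \<inter> unit_steps) \<inter> space M = \<sigma> k -` A \<inter> space M"
    using step_in_unit_steps k by auto
  finally show ?thesis .
qed

lemma time_event: "k \<ge> 1 \<Longrightarrow> N k -` A \<inter> space M \<in> events"
proof -
  assume k: "k \<ge> 1"
  have "N k -` (A \<inter> {1..k}) \<inter> space M \<in> events"
    by (rule measurable_sets[OF measurable_time[OF k]]) auto
  also have "N k -` (A \<inter> {1..k}) \<inter> space M = N k -` A \<inter> space M"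
    using time_in_range k by auto
  finally show ?thesis .
qed

lemma space_history [simp]: "space (history M \<sigma> N m n) = space M"
  unfolding history_def by (rule space_measure_of) auto

lemma sets_history:
  "sets (history M \<sigma> N m n) = sigma_sets (space M)
     ({\<sigma> k -` A \<inter> space M | k A. k \<in> {1..m}} \<union> {N k -` A \<inter> space M | k A. k \<in> {1..n}})"
  unfolding history_def by (rule sets_measure_of) auto

lemma subalgebra_history: "subalgebra M (history M \<sigma> N m n)"
  unfolding subalgebra_def sets_history
  using step_event time_event by (auto intro!: sets.sigma_sets_subset)

lemma sets_history_mono:
  "m \<le> m' \<Longrightarrow> n \<le> n' \<Longrightarrow> sets (history M \<sigma> N m n) \<subseteq> sets (history M \<sigma> N m' n')"
  unfolding sets_history
  by (intro sigma_sets_mono' Un_mono subsetI) (elim CollectE exE conjE; force)+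

lemma measurable_history_mono:
  "f \<in> measurable (history M \<sigma> N m n) L \<Longrightarrow> m \<le> m' \<Longrightarrow> n \<le> n' \<Longrightarrow>
     f \<in> measurable (history M \<sigma> N m' n') L"
  using sets_history_mono[of m m' n n'] unfolding measurable_def space_history by blast

lemma measurable_step_history:
  "k \<in> {1..m} \<Longrightarrow> \<sigma> k \<in> measurable (history M \<sigma> N m n) (count_space UNIV)"
  by (rule measurableI) (auto simp: sets_history intro!: sigma_sets.Basic)

lemma measurable_fun_step_history:
  fixes h :: "real ^ 'd \<Rightarrow> 'b::topological_space"
  shows "k \<in> {1..m} \<Longrightarrow> (\<lambda>\<omega>. h (\<sigma> k \<omega>)) \<in> borel_measurable (history M \<sigma> N m n)"
  by (rule measurable_compose[OF measurable_step_history]) auto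

lemma measurable_from_history:
  "f \<in> measurable (history M \<sigma> N m n) L \<Longrightarrow> f \<in> measurable M L"
  by (rule measurable_from_subalg[OF subalgebra_history])

lemma finite_measure_subalgebra_history: "finite_measure_subalgebra M (history M \<sigma> N m n)"
  by unfold_locales (rule subalgebra_history)

text \<open>Independence of \<open>N n\<close> from the past makes its conditional probabilities given the past constant;
  this passes from events to functions.\<close>
lemma expectation_time_indicator:
  fixes f :: "'w \<Rightarrow> real"
  assumes n: "n \<ge> 1" and k: "k \<in> {1..n}"
    and f: "f \<in> borel_measurable (past n)" and B: "\<And>\<omega>. \<omega> \<in> space M \<Longrightarrow> \<bar>f \<omega>\<bar> \<le> B"
  shows "expectation (\<lambda>\<omega>. f \<omega> * indicator {\<omega> \<in> space M. N n \<omega> = k} \<omega>) = expectation f / n"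
proof -
  interpret P: finite_measure_subalgebra M "past n" by (rule finite_measure_subalgebra_history)
  define T where "T = {\<omega> \<in> space M. N n \<omega> = k}"
  have T: "T = N n -` {k} \<inter> space M" by (auto simp: T_def)
  have T_event [measurable]: "T \<in> events" unfolding T by (rule time_event[OF n])
  have "prob T = measure (distr M (count_space {1..n}) (N n)) {k}"
    unfolding T using k by (subst measure_distr[OF measurable_time[OF n]]) auto
  also have "\<dots> = 1 / n"
    unfolding time_uniform[OF n] using k by (subst measure_uniform_count_measure) auto
  finally have pT: "prob T = 1 / n" .
  have indep: "prob (A \<inter> T) = prob A / n" if A: "A \<in> sets (past n)" for A
  proof -
    have "T \<in> {N n -` A \<inter> space M | A. True}" unfolding T by blast
    from indep_setD[OF time_indep[OF n] A this] show ?thesis using pT by simp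
  qed
  have "AE \<omega> in M. real_cond_exp M (past n) (indicator T) \<omega> = 1 / real n"
  proof (rule P.real_cond_exp_charact)
    fix A assume A: "A \<in> sets (past n)"
    then have A': "A \<in> events" using subalgebra_history by (auto simp: subalgebra_def)
    have "set_lebesgue_integral M A (indicator T) = expectation (indicator (A \<inter> T))"
      unfolding set_lebesgue_integral_def
      by (intro Bochner_Integration.integral_cong) (auto simp: indicator_def)
    also have "\<dots> = prob A / n" using A' indep[OF A] by simp
    finally show "set_lebesgue_integral M A (indicator T) = set_lebesgue_integral M A (\<lambda>\<omega>. 1 / real n)"
      using A' by (simp add: set_lebesgue_integral_def)
  qed (auto intro!: integrable_bounded[of _ 1] simp: indicator_def)
  then have "expectation (\<lambda>\<omega>. f \<omega> * real_cond_exp M (past n) (indicator T) \<omega>)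
      = expectation (\<lambda>\<omega>. f \<omega> * (1 / real n))"
    using f[THEN measurable_from_history] by (intro integral_cong_AE) auto
  moreover have "expectation (\<lambda>\<omega>. f \<omega> * real_cond_exp M (past n) (indicator T) \<omega>)
      = expectation (\<lambda>\<omega>. f \<omega> * indicator T \<omega>)"
  proof (rule P.real_cond_exp_intg(2))
    show "integrable M (\<lambda>\<omega>. f \<omega> * indicator T \<omega>)"
    proof (rule integrable_bounded)
      fix \<omega> assume "\<omega> \<in> space M"
      from B[OF this] show "\<bar>f \<omega> * indicator T \<omega>\<bar> \<le> B" by (auto simp: indicator_def)
    qed (use f[THEN measurable_from_history] in simp)
  qed (use f in auto)
  ultimately show ?thesis by (simp add: T_def)
qed

text \<open>The bridge from the probabilistic hypotheses to the averaging operator. The function \<open>g\<close> may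
  depend on the past, so with the indicator of a past event as a factor this is a statement about
  conditional expectations. Given also \<open>N n\<close>, the step law replaces the indicator of
  \<open>\<sigma> (Suc n) = x\<close> by \<open>p\<close> or \<open>q\<close>; then \<open>N n\<close> is averaged out uniformly.\<close>
lemma expectation_next_step:
  fixes g :: "'w \<Rightarrow> real ^ 'd \<Rightarrow> real"
  assumes n: "n \<ge> 1"
    and g: "\<And>x. x \<in> unit_steps \<Longrightarrow> (\<lambda>\<omega>. g \<omega> x) \<in> borel_measurable (past n)"
    and B: "\<And>\<omega> x. \<omega> \<in> space M \<Longrightarrow> x \<in> unit_steps \<Longrightarrow> \<bar>g \<omega> x\<bar> \<le> B"
  shows "expectation (\<lambda>\<omega>. g \<omega> (\<sigma> (Suc n) \<omega>)) = expectation (\<lambda>\<omega>. step_mean p (\<lambda>k. \<sigma> k \<omega>) n (g \<omega>))"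
    and "(\<lambda>\<omega>. g \<omega> (\<sigma> (Suc n) \<omega>)) \<in> borel_measurable (past (Suc n))"
    and "(\<lambda>\<omega>. step_mean p (\<lambda>k. \<sigma> k \<omega>) n (g \<omega>)) \<in> borel_measurable (past n)"
proof -
  interpret P: finite_measure_subalgebra M "history M \<sigma> N n n"
    by (rule finite_measure_subalgebra_history)
  define q where "q = (1 - p) / (2 * real CARD('d) - 1)"
  define E where "E k x = {\<omega> \<in> space M. \<sigma> k \<omega> = x}" for k x
  define T where "T k = {\<omega> \<in> space M. N n \<omega> = k}" for k
  have at: "g \<omega> (\<sigma> k \<omega>) = (\<Sum>x\<in>unit_steps. g \<omega> x * indicator (E k x) \<omega>)"
    if "\<omega> \<in> space M" "k \<ge> 1" for \<omega> k
  proof -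
    have "(\<Sum>x\<in>unit_steps. g \<omega> x * indicator (E k x) \<omega>)
        = (\<Sum>x\<in>unit_steps. if x = \<sigma> k \<omega> then g \<omega> x else 0)"
      using that by (intro sum.cong) (auto simp: E_def indicator_def)
    then show ?thesis using step_in_unit_steps[OF that] by simp
  qed
  have E_hist: "E k x \<in> sets (history M \<sigma> N m l)" if "k \<in> {1..m}" for k x m l
  proof -
    have "E k x = \<sigma> k -` {x} \<inter> space M" by (auto simp: E_def)
    then show ?thesis using that by (auto simp: sets_history intro!: sigma_sets.Basic)
  qed
  have g_at: "(\<lambda>\<omega>. g \<omega> (\<sigma> k \<omega>)) \<in> borel_measurable (history M \<sigma> N m l)"
    if "k \<in> {1..m}" "n \<le> m" "n - 1 \<le> l" for k m l
  proof (subst measurable_cong[OF at])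
    show "(\<lambda>\<omega>. \<Sum>x\<in>unit_steps. g \<omega> x * indicator (E k x) \<omega>) \<in> borel_measurable (history M \<sigma> N m l)"
      using measurable_history_mono[OF g] E_hist that
      by (intro borel_measurable_sum borel_measurable_times borel_measurable_indicator) auto
  qed (use that in auto)
  show "(\<lambda>\<omega>. g \<omega> (\<sigma> (Suc n) \<omega>)) \<in> borel_measurable (past (Suc n))"
    by (rule g_at) auto
  show step_meas: "(\<lambda>\<omega>. step_mean p (\<lambda>k. \<sigma> k \<omega>) n (g \<omega>)) \<in> borel_measurable (past n)"
    unfolding step_mean_def Let_def using g g_at
    by (intro borel_measurable_add borel_measurable_times borel_measurable_sum borel_measurable_const) auto
  have gM: "(\<lambda>\<omega>. g \<omega> x) \<in> borel_measurable M" if "x \<in> unit_steps" for x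
    using g[OF that] by (rule measurable_from_history)
  have g_atM: "(\<lambda>\<omega>. g \<omega> (\<sigma> k \<omega>)) \<in> borel_measurable M" if "k \<in> {1..n}" for k
    using g_at[of k n "n - 1"] that by (auto intro: measurable_from_history)
  have E_ev: "E (Suc n) x \<in> events" for x
    using E_hist[of "Suc n" "Suc n" x n] subalgebra_history by (auto simp: subalgebra_def)
  have T_ev: "T k \<in> events" for k
  proof -
    have "T k = N n -` {k} \<inter> space M" by (auto simp: T_def)
    then show ?thesis using time_event[OF n] by simp
  qed
  have B0: "\<bar>g \<omega> x * indicator A \<omega>\<bar> \<le> B" if "\<omega> \<in> space M" "x \<in> unit_steps" for \<omega> x A
    using B[OF that] by (auto simp: indicator_def)
  have int_g: "integrable M (\<lambda>\<omega>. g \<omega> x)" if "x \<in> unit_steps" for x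
    using gM that B by (intro integrable_bounded[of _ B]) auto
  have int_E: "integrable M (\<lambda>\<omega>. g \<omega> x * indicator (E (Suc n) x) \<omega>)" if "x \<in> unit_steps" for x
    using gM that B0 E_ev by (intro integrable_bounded[of _ B]) auto
  have int_T: "integrable M (\<lambda>\<omega>. g \<omega> (\<sigma> k \<omega>) * indicator (T k) \<omega>)" if "k \<in> {1..n}" for k
    using g_atM that B0 T_ev step_in_unit_steps by (intro integrable_bounded[of _ B]) auto
  have int_at: "integrable M (\<lambda>\<omega>. g \<omega> (\<sigma> k \<omega>))" if "k \<in> {1..n}" for k
    using g_atM that B step_in_unit_steps by (intro integrable_bounded[of _ B]) auto
  have linear: "expectation (\<lambda>\<omega>. c * (\<Sum>k = 1..n. f k \<omega>) + q * (\<Sum>x\<in>unit_steps. g \<omega> x))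
      = c * (\<Sum>k = 1..n. expectation (f k)) + q * (\<Sum>x\<in>unit_steps. expectation (\<lambda>\<omega>. g \<omega> x))"
    if f: "\<And>k. k \<in> {1..n} \<Longrightarrow> integrable M (f k)" for c f
  proof -
    have "integrable M (\<lambda>\<omega>. \<Sum>k = 1..n. f k \<omega>)" "integrable M (\<lambda>\<omega>. \<Sum>x\<in>unit_steps. g \<omega> x)"
      using f int_g by (auto intro!: Bochner_Integration.integrable_sum)
    then show ?thesis
      using f int_g by (simp only: Bochner_Integration.integral_add integrable_mult_right
          integral_mult_right_zero Bochner_Integration.integral_sum)
  qed
  define r where "r x \<omega> = (if x = \<sigma> (N n \<omega>) \<omega> then p else q)" for x \<omega>
  have cond: "expectation (\<lambda>\<omega>. g \<omega> x * indicator (E (Suc n) x) \<omega>) = expectation (\<lambda>\<omega>. g \<omega> x * r x \<omega>)"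
    and int_r: "integrable M (\<lambda>\<omega>. g \<omega> x * r x \<omega>)"
    if x: "x \<in> unit_steps" for x
  proof -
    have gx: "(\<lambda>\<omega>. g \<omega> x) \<in> borel_measurable (history M \<sigma> N n n)"
      using measurable_history_mono[OF g[OF x]] by simp
    have AE: "AE \<omega> in M. g \<omega> x * real_cond_exp M (history M \<sigma> N n n) (indicator (E (Suc n) x)) \<omega>
        = g \<omega> x * r x \<omega>"
      using step_conditional[OF n x] by eventually_elim (auto simp: r_def q_def E_def)
    have r_meas: "r x \<in> borel_measurable M"
    proof -
      have "r x \<omega> = (\<Sum>k = 1..n. (if x = \<sigma> k \<omega> then p else q) * indicator (T k) \<omega>)"
        if "\<omega> \<in> space M" for \<omega>
      proof -
        have "(\<Sum>k = 1..n. (if x = \<sigma> k \<omega> then p else q) * indicator (T k) \<omega>)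
            = (\<Sum>k = 1..n. if k = N n \<omega> then r x \<omega> else 0)"
          using that by (intro sum.cong) (auto simp: T_def r_def)
        then show ?thesis using time_in_range[OF that n] by simp
      qed
      moreover have "(\<lambda>\<omega>. \<Sum>k = 1..n. (if x = \<sigma> k \<omega> then p else q) * indicator (T k) \<omega>) \<in> borel_measurable M"
        using T_ev measurable_from_history[OF measurable_fun_step_history[of _ n "\<lambda>y. if x = y then p else q"]]
        by (intro borel_measurable_sum borel_measurable_times borel_measurable_indicator) auto
      ultimately show ?thesis by (simp cong: measurable_cong)
    qed
    have i: "integrable M (\<lambda>\<omega>. g \<omega> x * real_cond_exp M (history M \<sigma> N n n) (indicator (E (Suc n) x)) \<omega>)"
      and e: "expectation (\<lambda>\<omega>. g \<omega> x * real_cond_exp M (history M \<sigma> N n n) (indicator (E (Suc n) x)) \<omega>)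
          = expectation (\<lambda>\<omega>. g \<omega> x * indicator (E (Suc n) x) \<omega>)"
      using P.real_cond_exp_intg[OF int_E[OF x] gx] E_ev by auto
    have rg: "(\<lambda>\<omega>. g \<omega> x * r x \<omega>) \<in> borel_measurable M" using r_meas gM[OF x] by simp
    show "expectation (\<lambda>\<omega>. g \<omega> x * indicator (E (Suc n) x) \<omega>) = expectation (\<lambda>\<omega>. g \<omega> x * r x \<omega>)"
      unfolding e[symmetric] using AE rg gM[OF x] by (intro integral_cong_AE) auto
    show "integrable M (\<lambda>\<omega>. g \<omega> x * r x \<omega>)"
      using i integrable_cong_AE[THEN iffD1, OF _ rg AE] gM[OF x] by auto
  qed
  have "expectation (\<lambda>\<omega>. g \<omega> (\<sigma> (Suc n) \<omega>))
      = expectation (\<lambda>\<omega>. \<Sum>x\<in>unit_steps. g \<omega> x * indicator (E (Suc n) x) \<omega>)"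
    by (intro Bochner_Integration.integral_cong) (auto simp: at)
  also have "\<dots> = (\<Sum>x\<in>unit_steps. expectation (\<lambda>\<omega>. g \<omega> x * r x \<omega>))"
    using int_E by (subst Bochner_Integration.integral_sum) (auto simp: cond)
  also have "\<dots> = expectation (\<lambda>\<omega>. \<Sum>x\<in>unit_steps. g \<omega> x * r x \<omega>)"
    using int_r by (subst Bochner_Integration.integral_sum) auto
  also have "\<dots> = expectation (\<lambda>\<omega>. (p - q) * (\<Sum>k = 1..n. g \<omega> (\<sigma> k \<omega>) * indicator (T k) \<omega>)
      + q * (\<Sum>x\<in>unit_steps. g \<omega> x))"
  proof (intro Bochner_Integration.integral_cong refl)
    fix \<omega> assume w: "\<omega> \<in> space M"
    let ?y = "\<sigma> (N n \<omega>) \<omega>"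
    have N: "N n \<omega> \<in> {1..n}" by (rule time_in_range[OF w n])
    then have y: "?y \<in> unit_steps" using step_in_unit_steps[OF w] by simp
    have "(\<Sum>x\<in>unit_steps. g \<omega> x * r x \<omega>)
        = (\<Sum>x\<in>unit_steps. (if x = ?y then (p - q) * g \<omega> x else 0) + q * g \<omega> x)"
      by (intro sum.cong) (auto simp: r_def algebra_simps)
    also have "\<dots> = (p - q) * g \<omega> ?y + q * (\<Sum>x\<in>unit_steps. g \<omega> x)"
      using y by (simp add: sum.distrib sum_distrib_left)
    also have "g \<omega> ?y = (\<Sum>k = 1..n. if k = N n \<omega> then g \<omega> (\<sigma> k \<omega>) else 0)" using N by simp
    also have "\<dots> = (\<Sum>k = 1..n. g \<omega> (\<sigma> k \<omega>) * indicator (T k) \<omega>)"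
      using w by (intro sum.cong) (auto simp: T_def)
    finally show "(\<Sum>x\<in>unit_steps. g \<omega> x * r x \<omega>)
        = (p - q) * (\<Sum>k = 1..n. g \<omega> (\<sigma> k \<omega>) * indicator (T k) \<omega>) + q * (\<Sum>x\<in>unit_steps. g \<omega> x)" .
  qed
  also have "\<dots> = (p - q) * (\<Sum>k = 1..n. expectation (\<lambda>\<omega>. g \<omega> (\<sigma> k \<omega>) * indicator (T k) \<omega>))
      + q * (\<Sum>x\<in>unit_steps. expectation (\<lambda>\<omega>. g \<omega> x))"
    by (rule linear[OF int_T])
  also have "(\<Sum>k = 1..n. expectation (\<lambda>\<omega>. g \<omega> (\<sigma> k \<omega>) * indicator (T k) \<omega>))
      = (\<Sum>k = 1..n. expectation (\<lambda>\<omega>. g \<omega> (\<sigma> k \<omega>)) / n)"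
    unfolding T_def using n g_at B step_in_unit_steps
    by (intro sum.cong refl expectation_time_indicator[of _ _ _ B]) auto
  also have "(p - q) * \<dots> + q * (\<Sum>x\<in>unit_steps. expectation (\<lambda>\<omega>. g \<omega> x))
      = (p - q) / n * (\<Sum>k = 1..n. expectation (\<lambda>\<omega>. g \<omega> (\<sigma> k \<omega>)))
        + q * (\<Sum>x\<in>unit_steps. expectation (\<lambda>\<omega>. g \<omega> x))"
    by (simp flip: sum_divide_distrib)
  also have "\<dots> = expectation (\<lambda>\<omega>. (p - q) / n * (\<Sum>k = 1..n. g \<omega> (\<sigma> k \<omega>)) + q * (\<Sum>x\<in>unit_steps. g \<omega> x))"
    by (rule linear[OF int_at, symmetric])
  finally show "expectation (\<lambda>\<omega>. g \<omega> (\<sigma> (Suc n) \<omega>)) = expectation (\<lambda>\<omega>. step_mean p (\<lambda>k. \<sigma> k \<omega>) n (g \<omega>))"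
    by (simp add: step_mean_def q_def)
qed

end

section \<open>Balance between the axes\<close>

context merw
begin

text \<open>A step along axis \<open>i\<close> contributes \<open>1\<close>, every other step \<open>0\<close>.\<close>
definition axis_steps :: "'d \<Rightarrow> nat \<Rightarrow> 'w \<Rightarrow> real" where
  "axis_steps i n \<omega> = (\<Sum>k = 1..n. (\<sigma> k \<omega> $ i)\<^sup>2)"

definition excess :: "'d \<Rightarrow> nat \<Rightarrow> 'w \<Rightarrow> real" where
  "excess i n \<omega> = axis_steps i n \<omega> - n / CARD('d)"

lemma axis_steps_Suc: "axis_steps i (Suc n) \<omega> = axis_steps i n \<omega> + (\<sigma> (Suc n) \<omega> $ i)\<^sup>2"
  by (simp add: axis_steps_def)

lemma excess_Suc: "excess i (Suc n) \<omega> = excess i n \<omega> + (\<sigma> (Suc n) \<omega> $ i)\<^sup>2 - 1 / CARD('d)"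
  by (simp add: excess_def axis_steps_Suc add_divide_distrib)

lemma walk_eq_sum: "\<omega> \<in> space M \<Longrightarrow> S n \<omega> = (\<Sum>k = 1..n. \<sigma> k \<omega>)"
  by (induction n) (simp_all add: walk_0 walk_Suc)

lemma step_history:
  assumes "p \<ge> 1 / (2 * real CARD('d))" "\<omega> \<in> space M" "n \<ge> 1"
  shows "step_history p (\<lambda>k. \<sigma> k \<omega>) n"
  using assms memory step_in_unit_steps by unfold_locales auto

lemma axis_steps_bounds:
  assumes "\<omega> \<in> space M"
  shows "0 \<le> axis_steps i n \<omega>" "axis_steps i n \<omega> \<le> n"
proof -
  have "(\<sigma> k \<omega> $ i)\<^sup>2 \<le> 1" if "k \<in> {1..n}" for k
    using unit_step_component_sq[of "\<sigma> k \<omega>" i] step_in_unit_steps[OF assms, of k] that by auto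
  then show "axis_steps i n \<omega> \<le> n"
    unfolding axis_steps_def using sum_bounded_above[of "{1..n}" "\<lambda>k. (\<sigma> k \<omega> $ i)\<^sup>2" 1] by simp
qed (simp add: axis_steps_def sum_nonneg)

lemma excess_bound: "\<omega> \<in> space M \<Longrightarrow> \<bar>excess i n \<omega>\<bar> \<le> n"
proof -
  assume w: "\<omega> \<in> space M"
  have "real n / CARD('d) \<le> n" by (simp add: divide_le_eq mult_le_cancel_left1 Suc_leI)
  moreover have "0 \<le> real n / CARD('d)" by simp
  ultimately show ?thesis using axis_steps_bounds[OF w, of i n] unfolding excess_def by linarith
qed

lemma measurable_axis_steps: "n \<le> m \<Longrightarrow> axis_steps i n \<in> borel_measurable (history M \<sigma> N m l)"
  unfolding axis_steps_def[abs_def]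
  by (intro borel_measurable_sum measurable_fun_step_history) auto

lemma measurable_excess: "n \<le> m \<Longrightarrow> excess i n \<in> borel_measurable (history M \<sigma> N m l)"
  unfolding excess_def[abs_def] using measurable_axis_steps by auto

lemma measurable_walk: "n \<le> m \<Longrightarrow> S n \<in> borel_measurable (history M \<sigma> N m l)"
proof (subst measurable_cong)
  show "S n \<omega> = (\<Sum>k = 1..n. \<sigma> k \<omega>)" if "\<omega> \<in> space (history M \<sigma> N m l)" for \<omega>
    using that by (simp add: walk_eq_sum)
  assume "n \<le> m"
  then show "(\<lambda>\<omega>. \<Sum>k = 1..n. \<sigma> k \<omega>) \<in> borel_measurable (history M \<sigma> N m l)"
    by (intro borel_measurable_sum measurable_fun_step_history[of _ _ "\<lambda>x. x"]) auto
qed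

lemma past_event: "A \<in> sets (past n) \<Longrightarrow> A \<in> events"
  using subalgebra_history by (auto simp: subalgebra_def)

text \<open>The surplus \<open>p - q\<close> of the averaging operator, stated without reference to a fixed past.\<close>
definition reinforcement :: real where
  "reinforcement = p - (1 - p) / (2 * real CARD('d) - 1)"

lemma reinforcement_bounds:
  assumes "p \<ge> 1 / (2 * real CARD('d))" "p < 1"
  shows "0 \<le> reinforcement" "reinforcement < 1"
proof -
  obtain \<omega> where w: "\<omega> \<in> space M" using not_empty by blast
  interpret step_history p "\<lambda>k. \<sigma> k \<omega>" 1
    using step_history[OF assms(1) w] by simp
  show "0 \<le> reinforcement" using p_ge_q by (simp add: reinforcement_def q_def)
  have "(1 - p) / (2 * real CARD('d) - 1) > 0" using assms denominator_pos by simp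
  then show "reinforcement < 1" using assms by (simp add: reinforcement_def)
qed

lemma integrable_excess_sq: "integrable M (\<lambda>\<omega>. (excess i n \<omega>)\<^sup>2)"
proof (rule integrable_bounded[of _ "(real n)\<^sup>2"])
  show "\<bar>(excess i n \<omega>)\<^sup>2\<bar> \<le> (real n)\<^sup>2" if "\<omega> \<in> space M" for \<omega>
    using excess_bound[OF that, of i n] by (simp add: abs_le_square_iff[symmetric])
qed (use measurable_excess[of n n i "n - 1", THEN measurable_from_history] in auto)

lemma excess_sq_step:
  assumes p: "p \<ge> 1 / (2 * real CARD('d))" and n: "n \<ge> 1" and A: "A \<in> sets (past n)"
  shows "expectation (\<lambda>\<omega>. indicator A \<omega> * (excess i (Suc n) \<omega>)\<^sup>2)
    \<le> expectation (\<lambda>\<omega>. indicator A \<omega> * ((1 + 2 * reinforcement / n) * (excess i n \<omega>)\<^sup>2 + 1))"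
proof -
  define g where "g \<omega> x = indicator A \<omega> * (excess i n \<omega> + (x $ i)\<^sup>2 - 1 / CARD('d))\<^sup>2"
    for \<omega> and x :: "real ^ 'd"
  have g_meas: "(\<lambda>\<omega>. g \<omega> x) \<in> borel_measurable (past n)" for x
    unfolding g_def using A measurable_excess[of n n i "n - 1"] by auto
  have g_bound: "\<bar>g \<omega> x\<bar> \<le> (real n + 1)\<^sup>2" if "\<omega> \<in> space M" "x \<in> unit_steps" for \<omega> x
  proof -
    have "0 \<le> 1 / real CARD('d)" "1 / real CARD('d) \<le> 1" by (simp_all add: Suc_leI)
    moreover have "0 \<le> (x $ i)\<^sup>2" "(x $ i)\<^sup>2 \<le> 1" using unit_step_component_sq[OF that(2), of i] by auto
    ultimately have "\<bar>excess i n \<omega> + (x $ i)\<^sup>2 - 1 / CARD('d)\<bar> \<le> real n + 1"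
      using excess_bound[OF that(1), of i n] by linarith
    then have "(excess i n \<omega> + (x $ i)\<^sup>2 - 1 / CARD('d))\<^sup>2 \<le> (real n + 1)\<^sup>2"
      by (simp add: abs_le_square_iff[symmetric])
    then show ?thesis by (auto simp: g_def indicator_def)
  qed
  note next_step = expectation_next_step[OF n g_meas g_bound, simplified]
  have le: "step_mean p (\<lambda>k. \<sigma> k \<omega>) n (g \<omega>)
      \<le> indicator A \<omega> * ((1 + 2 * reinforcement / n) * (excess i n \<omega>)\<^sup>2 + 1)"
    if w: "\<omega> \<in> space M" for \<omega>
  proof -
    interpret step_history p "\<lambda>k. \<sigma> k \<omega>" n by (rule step_history[OF p w n])
    have "step_mean p (\<lambda>k. \<sigma> k \<omega>) n (g \<omega>)
        = indicator A \<omega> * step_mean p (\<lambda>k. \<sigma> k \<omega>) n (\<lambda>x. (excess i n \<omega> + (x $ i)\<^sup>2 - 1 / CARD('d))\<^sup>2)"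
      unfolding g_def by (rule step_mean_cmult)
    also have "\<dots> \<le> indicator A \<omega> * ((1 + 2 * reinforcement / n) * (excess i n \<omega>)\<^sup>2 + 1)"
      using step_mean_axis_deviation[of i]
      by (intro mult_left_mono) (simp_all add: excess_def axis_steps_def reinforcement_def q_def)
    finally show ?thesis .
  qed
  have "integrable M (\<lambda>\<omega>. indicator A \<omega> *\<^sub>R ((1 + 2 * reinforcement / n) * (excess i n \<omega>)\<^sup>2 + 1))"
    using integrable_excess_sq past_event[OF A] by (intro integrable_mult_indicator) auto
  then have int2: "integrable M (\<lambda>\<omega>. indicator A \<omega> * ((1 + 2 * reinforcement / n) * (excess i n \<omega>)\<^sup>2 + 1))"
    by simp
  have "0 \<le> step_mean p (\<lambda>k. \<sigma> k \<omega>) n (g \<omega>)" if w: "\<omega> \<in> space M" for \<omega>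
  proof -
    interpret step_history p "\<lambda>k. \<sigma> k \<omega>" n by (rule step_history[OF p w n])
    show ?thesis using step_mean_mono[of "\<lambda>x. 0" "g \<omega>"] by (simp add: step_mean_const g_def)
  qed
  then have int3: "integrable M (\<lambda>\<omega>. step_mean p (\<lambda>k. \<sigma> k \<omega>) n (g \<omega>))"
    using le next_step(3)[THEN measurable_from_history]
    by (intro Bochner_Integration.integrable_bound[OF int2]) (auto intro!: AE_I2 order_trans[OF _ abs_ge_self])
  have "expectation (\<lambda>\<omega>. indicator A \<omega> * (excess i (Suc n) \<omega>)\<^sup>2) = expectation (\<lambda>\<omega>. g \<omega> (\<sigma> (Suc n) \<omega>))"
    by (simp add: g_def excess_Suc)
  also have "\<dots> = expectation (\<lambda>\<omega>. step_mean p (\<lambda>k. \<sigma> k \<omega>) n (g \<omega>))" by (rule next_step(1))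
  also have "\<dots> \<le> expectation (\<lambda>\<omega>. indicator A \<omega> * ((1 + 2 * reinforcement / n) * (excess i n \<omega>)\<^sup>2 + 1))"
    using le by (intro integral_mono int2 int3) auto
  finally show ?thesis .
qed

lemma expectation_excess_sq_le:
  assumes p: "p \<ge> 1 / (2 * real CARD('d))" "p < 1" and n: "n \<ge> 1"
  shows "expectation (\<lambda>\<omega>. (excess i n \<omega>)\<^sup>2) \<le> n powr (1 + reinforcement) / (1 - reinforcement)"
proof (rule second_moment_growth[OF _ _ reinforcement_bounds[OF p] n])
  have "expectation (\<lambda>\<omega>. (excess i 1 \<omega>)\<^sup>2) \<le> expectation (\<lambda>\<omega>. 1)"
  proof (rule integral_mono)
    show "(excess i 1 \<omega>)\<^sup>2 \<le> 1" if "\<omega> \<in> space M" for \<omega>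
      using excess_bound[OF that, of i 1] by (simp add: abs_square_le_1)
  qed (auto intro: integrable_excess_sq)
  then show "expectation (\<lambda>\<omega>. (excess i 1 \<omega>)\<^sup>2) \<le> 1" by (simp add: prob_space)
next
  fix m :: nat assume m: "m \<ge> 1"
  have "expectation (\<lambda>\<omega>. indicator (space M) \<omega> * (excess i (Suc m) \<omega>)\<^sup>2)
    \<le> expectation (\<lambda>\<omega>. indicator (space M) \<omega> * ((1 + 2 * reinforcement / m) * (excess i m \<omega>)\<^sup>2 + 1))"
    by (rule excess_sq_step[OF p(1) m]) (use sets.top[of "past m"] in simp)
  then have "expectation (\<lambda>\<omega>. (excess i (Suc m) \<omega>)\<^sup>2)
    \<le> expectation (\<lambda>\<omega>. (1 + 2 * reinforcement / m) * (excess i m \<omega>)\<^sup>2 + 1)"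
    by (simp cong: Bochner_Integration.integral_cong)
  then show "expectation (\<lambda>\<omega>. (excess i (Suc m) \<omega>)\<^sup>2)
    \<le> (1 + 2 * reinforcement / m) * expectation (\<lambda>\<omega>. (excess i m \<omega>)\<^sup>2) + 1"
    using integrable_excess_sq by (simp add: prob_space)
qed

text \<open>By the second moment recursion and \<open>2 a \<le> 2\<close>, the normalised square \<open>(excess / m)\<^sup>2\<close> is a
  supermartingale up to an error \<open>1 / (m + 1)\<^sup>2\<close> per step. Adding \<open>1 / m\<close> compensates for all later
  errors.\<close>
lemma prob_axis_deviation_le:
  fixes n :: nat
  assumes p: "p \<ge> 1 / (2 * real CARD('d))" "p < 1" and n: "n \<ge> 1" and e: "e > 0"
  shows "prob {\<omega> \<in> space M. \<exists>m\<ge>n. e \<le> (excess i m \<omega> / m)\<^sup>2 + 1 / m}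
    \<le> (n powr (reinforcement - 1) / (1 - reinforcement) + 1 / n) / e"
proof -
  define U where "U m \<omega> = (excess i m \<omega> / m)\<^sup>2 + 1 / m" for m :: nat and \<omega>
  have int: "integrable M (U m)" for m
    unfolding U_def using integrable_excess_sq by (simp add: power_divide)
  have int_A: "integrable M (\<lambda>\<omega>. indicator A \<omega> * h \<omega>)" if "A \<in> events" "integrable M h" for A and h :: "'w \<Rightarrow> real"
    using integrable_mult_indicator[OF that] by simp
  have "prob {\<omega> \<in> space M. \<exists>m\<ge>n. e \<le> U m \<omega>} \<le> expectation (U n) / e"
  proof (rule supermartingale_maximal_inequality[where F = past])
    show "subalgebra M (past m)" for m by (rule subalgebra_history)
    show "sets (past m) \<subseteq> sets (past (Suc m))" for m by (rule sets_history_mono) auto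
    show "U m \<in> borel_measurable (past m)" for m
      unfolding U_def using measurable_excess[of m m i "m - 1"] by auto
    show "0 \<le> U m \<omega>" for m \<omega> by (simp add: U_def)
    show "integrable M (U m)" for m by (rule int)
    show "e > 0" by (rule e)
    fix m A assume "n \<le> m" and A: "A \<in> sets (past m)"
    with n have m: "m \<ge> 1" by simp
    have A_ev: "A \<in> events" by (rule past_event[OF A])
    have "(\<integral>\<omega>. indicator A \<omega> * U (Suc m) \<omega> \<partial>M)
        = (\<integral>\<omega>. indicator A \<omega> * (excess i (Suc m) \<omega>)\<^sup>2 / (real m + 1)\<^sup>2 + indicator A \<omega> / (real m + 1) \<partial>M)"
      by (simp add: U_def power_divide distrib_left add.commute)
    also have "\<dots> = (\<integral>\<omega>. indicator A \<omega> * (excess i (Suc m) \<omega>)\<^sup>2 \<partial>M) / (real m + 1)\<^sup>2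
        + prob A / (real m + 1)"
      using int_A[OF A_ev integrable_excess_sq] A_ev by (simp add: less_top[symmetric])
    also have "\<dots> \<le> expectation (\<lambda>\<omega>. indicator A \<omega> * ((1 + 2 * reinforcement / m) * (excess i m \<omega>)\<^sup>2 + 1)) / (real m + 1)\<^sup>2
        + prob A / (real m + 1)"
      using excess_sq_step[OF p(1) m A, of i] by (intro add_right_mono divide_right_mono) auto
    also have "\<dots> = expectation (\<lambda>\<omega>. indicator A \<omega> * ((1 + 2 * reinforcement / m) * (excess i m \<omega>)\<^sup>2 + 1) / (real m + 1)\<^sup>2
        + indicator A \<omega> / (real m + 1))"
      using int_A[OF A_ev, of "\<lambda>\<omega>. (1 + 2 * reinforcement / m) * (excess i m \<omega>)\<^sup>2 + 1"] A_ev integrable_excess_sq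
      by (simp add: less_top[symmetric])
    also have "\<dots> \<le> (\<integral>\<omega>. indicator A \<omega> * U m \<omega> \<partial>M)"
    proof (rule integral_mono)
      fix \<omega>
      define z where "z = (excess i m \<omega>)\<^sup>2"
      have "(1 + 2 * reinforcement / m) * z / (real m + 1)\<^sup>2 \<le> z / (real m)\<^sup>2"
      proof -
        have "(1 + 2 * reinforcement / m) * (real m)\<^sup>2 \<le> (real m + 1)\<^sup>2"
        proof -
          have "(1 + 2 * reinforcement / m) * (real m)\<^sup>2 = (real m)\<^sup>2 + 2 * (reinforcement * m)"
            using m by (simp add: power2_eq_square field_simps)
          moreover have "reinforcement * m \<le> 1 * real m"
            using reinforcement_bounds[OF p] by (intro mult_right_mono) auto
          ultimately show ?thesis by (simp add: power2_eq_square algebra_simps)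
        qed
        then have "(1 + 2 * reinforcement / m) * (real m)\<^sup>2 * z \<le> (real m + 1)\<^sup>2 * z"
          by (rule mult_right_mono) (simp add: z_def)
        then show ?thesis using m by (simp add: field_simps)
      qed
      moreover have "1 / (real m + 1)\<^sup>2 + 1 / (real m + 1) \<le> 1 / real m"
      proof -
        have "1 / (real m + 1)\<^sup>2 \<le> 1 / (real m * (real m + 1))"
          unfolding power2_eq_square using m by (intro divide_left_mono mult_right_mono mult_pos_pos) auto
        also have "\<dots> = 1 / real m - 1 / (real m + 1)" using m by (simp add: field_simps)
        finally show ?thesis by simp
      qed
      ultimately have "((1 + 2 * reinforcement / m) * z + 1) / (real m + 1)\<^sup>2 + 1 / (real m + 1) \<le> U m \<omega>"
        by (simp add: U_def z_def power_divide add_divide_distrib)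
      then show "indicator A \<omega> * ((1 + 2 * reinforcement / m) * (excess i m \<omega>)\<^sup>2 + 1) / (real m + 1)\<^sup>2
        + indicator A \<omega> / (real m + 1) \<le> indicator A \<omega> * U m \<omega>"
        by (simp add: z_def indicator_def)
    qed (use int_A[OF A_ev, of "\<lambda>\<omega>. (1 + 2 * reinforcement / m) * (excess i m \<omega>)\<^sup>2 + 1"]
          int_A[OF A_ev int] A_ev integrable_excess_sq in \<open>simp_all add: less_top[symmetric]\<close>)
    finally show "(\<integral>\<omega>. indicator A \<omega> * U (Suc m) \<omega> \<partial>M) \<le> (\<integral>\<omega>. indicator A \<omega> * U m \<omega> \<partial>M)" .
  qed
  also have "expectation (U n) \<le> n powr (reinforcement - 1) / (1 - reinforcement) + 1 / n"
  proof -
    have "expectation (U n) = expectation (\<lambda>\<omega>. (excess i n \<omega>)\<^sup>2) / (real n)\<^sup>2 + 1 / n"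
      unfolding U_def using integrable_excess_sq by (simp add: power_divide prob_space)
    also have "\<dots> \<le> n powr (1 + reinforcement) / (1 - reinforcement) / (real n)\<^sup>2 + 1 / n"
      using expectation_excess_sq_le[OF p n] by (intro add_right_mono divide_right_mono) auto
    also have "n powr (1 + reinforcement) / (1 - reinforcement) / (real n)\<^sup>2
        = n powr (reinforcement - 1) / (1 - reinforcement)"
      using n by (simp add: powr_add powr_diff power2_eq_square)
    finally show ?thesis .
  qed
  then have "expectation (U n) / e \<le> (n powr (reinforcement - 1) / (1 - reinforcement) + 1 / n) / e"
    using e by (intro divide_right_mono) auto
  finally show ?thesis by (simp add: U_def)
qed

definition unbalanced :: "nat \<Rightarrow> 'w set" where
  "unbalanced n = {\<omega> \<in> space M. \<exists>m\<ge>n. \<exists>i. axis_steps i m \<omega> > 3 / 8 * m}"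

lemma prob_unbalanced_tendsto_0:
  assumes d: "CARD('d) \<ge> 3" and p: "p \<ge> 1 / (2 * real CARD('d))" "p < 1"
  shows "(\<lambda>n. prob (unbalanced n)) \<longlonglongrightarrow> 0"
proof (rule tendsto_sandwich)
  let ?b = "\<lambda>n::nat. CARD('d) * ((n powr (reinforcement - 1) / (1 - reinforcement) + 1 / n) / (1 / 576))"
  show "\<forall>\<^sub>F n in sequentially. 0 \<le> prob (unbalanced n)" by simp
  have dev: "(1/24) \<le> excess i m \<omega> / m" if "axis_steps i m \<omega> > 3 / 8 * m" "m \<ge> 1" for i m \<omega>
  proof -
    have "real CARD('d) \<ge> 3" using d by linarith
    then have "1 / real CARD('d) \<le> 1 / 3" by (intro divide_left_mono) auto
    then have "real m * (1 / CARD('d)) \<le> real m * (1 / 3)" by (intro mult_left_mono) auto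
    then have "real m / 24 \<le> excess i m \<omega>" using that by (simp add: excess_def)
    then show ?thesis using that(2) by (simp add: field_simps)
  qed
  have "prob (unbalanced n) \<le> ?b n" if n: "n \<ge> 1" for n
  proof -
    \<comment> \<open>\<open>576 = 24\<^sup>2\<close>, and \<open>1/24 = 3/8 - 1/3\<close> bounds the normalised excess below at an unbalanced time.\<close>
    define D where "D i = {\<omega> \<in> space M. \<exists>m\<ge>n. 1 / 576 \<le> (excess i m \<omega> / m)\<^sup>2 + 1 / m}" for i
    have [measurable]: "excess i m \<in> borel_measurable M" for i m
      using measurable_excess[of m m i "m - 1", THEN measurable_from_history] by simp
    have D: "D i \<in> events" for i unfolding D_def by measurable
    have "unbalanced n \<subseteq> (\<Union>i. D i)"
    proof
      fix \<omega> assume "\<omega> \<in> unbalanced n"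
      then obtain m i where m: "\<omega> \<in> space M" "m \<ge> n" "axis_steps i m \<omega> > 3 / 8 * m"
        by (auto simp: unbalanced_def)
      have "(1/24)\<^sup>2 \<le> (excess i m \<omega> / m)\<^sup>2" using dev[OF m(3)] m n by (intro power_mono) auto
      then have "1 / 576 \<le> (excess i m \<omega> / m)\<^sup>2 + 1 / m"
        by (simp add: power2_eq_square add_increasing2)
      then show "\<omega> \<in> (\<Union>i. D i)" using m by (auto simp: D_def)
    qed
    then have "prob (unbalanced n) \<le> prob (\<Union>i. D i)" using D by (intro finite_measure_mono) auto
    also have "\<dots> \<le> (\<Sum>i\<in>UNIV. prob (D i))" using D by (intro finite_measure_subadditive_finite) auto
    also have "\<dots> \<le> (\<Sum>i\<in>(UNIV :: 'd set). (n powr (reinforcement - 1) / (1 - reinforcement) + 1 / n) / (1 / 576))"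
      unfolding D_def by (rule sum_mono, rule prob_axis_deviation_le[OF p n]) simp
    finally show ?thesis by simp
  qed
  then show "\<forall>\<^sub>F n in sequentially. prob (unbalanced n) \<le> ?b n"
    by (auto intro: eventually_sequentiallyI)
  have "(\<lambda>n. real n powr (reinforcement - 1)) \<longlonglongrightarrow> 0"
    using reinforcement_bounds[OF p]
    by (intro tendsto_neg_powr filterlim_real_sequentially) auto
  moreover have "(\<lambda>n. 1 / real n) \<longlonglongrightarrow> 0" by (rule lim_1_over_n)
  ultimately have "?b \<longlonglongrightarrow> CARD('d) * ((0 / (1 - reinforcement) + 0) / (1 / 576))"
    using reinforcement_bounds[OF p] by (intro tendsto_intros) auto
  then show "?b \<longlonglongrightarrow> 0" by simp
qed simp

end

section \<open>Decay of the stopped Lyapunov function\<close>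

context merw
begin

definition balanced :: "nat \<Rightarrow> nat \<Rightarrow> 'w set" where
  "balanced n m = {\<omega> \<in> space M. \<forall>k\<in>{n..m}. \<forall>i. axis_steps i k \<omega> \<le> 3 / 8 * k}"

text \<open>Setting the process to \<open>0\<close> from the first unbalanced time on makes the bound for its conditional
  mean, which depends on balance, valid at all times \<open>m \<ge> n\<close>.\<close>
definition stopped_lyap :: "nat \<Rightarrow> nat \<Rightarrow> 'w \<Rightarrow> real" where
  "stopped_lyap n m \<omega> = indicator (balanced n m) \<omega> * lyap (S m \<omega>)"

lemma balanced_past: "n \<le> m \<Longrightarrow> balanced n m \<in> sets (past m)"
proof -
  assume nm: "n \<le> m"
  have "balanced n m = {\<omega> \<in> space (past m). \<forall>k\<in>{n..m}. \<forall>i\<in>UNIV. axis_steps i k \<omega> \<le> 3 / 8 * k}"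
    by (simp add: balanced_def)
  also have "\<dots> \<in> sets (past m)"
  proof (intro sets.sets_Collect_finite_All')
    fix k and i :: 'd assume "k \<in> {n..m}"
    then have [measurable]: "axis_steps i k \<in> borel_measurable (past m)"
      by (intro measurable_axis_steps) auto
    show "{\<omega> \<in> space (past m). axis_steps i k \<omega> \<le> 3 / 8 * k} \<in> sets (past m)" by measurable
  qed (use nm in auto)
  finally show ?thesis .
qed

lemma measurable_lyap: "lyap \<in> borel_measurable (borel :: 'a::real_normed_vector measure)"
  unfolding lyap_def by measurable

lemma measurable_stopped_lyap: "n \<le> m \<Longrightarrow> stopped_lyap n m \<in> borel_measurable (past m)"
  unfolding stopped_lyap_def
  using balanced_past measurable_compose[OF measurable_walk measurable_lyap] by auto

lemma stopped_lyap_bounds: "0 \<le> stopped_lyap n m \<omega>" "stopped_lyap n m \<omega> \<le> 1"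
  using lyap_pos[of "S m \<omega>"] lyap_le_1[of "S m \<omega>"]
  by (auto simp: stopped_lyap_def indicator_def)

lemma stopped_lyap_step:
  assumes d: "CARD('d) \<ge> 3" and p: "p \<ge> 1 / (2 * real CARD('d))"
    and n: "n \<ge> 1" "n \<le> m" and A: "A \<in> sets (past m)"
  shows "expectation (\<lambda>\<omega>. indicator A \<omega> * stopped_lyap n (Suc m) \<omega>)
    \<le> expectation (\<lambda>\<omega>. indicator A \<omega> * (stopped_lyap n m \<omega> - stopped_lyap n m \<omega> ^ 5 / 200))"
proof -
  have m: "m \<ge> 1" using n by simp
  \<comment> \<open>Balance at time \<open>Suc m\<close> involves the next step and is dropped; the factor left is known at time \<open>m\<close>.\<close>
  define h where "h \<omega> = indicat_real A \<omega> * indicator (balanced n m) \<omega>" for \<omega>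
  define g where "g \<omega> x = h \<omega> * lyap (S m \<omega> + x)" for \<omega> and x :: "real ^ 'd"
  have h01: "0 \<le> h \<omega>" "h \<omega> \<le> 1" for \<omega> by (auto simp: h_def indicator_def)
  have g_meas: "(\<lambda>\<omega>. g \<omega> x) \<in> borel_measurable (past m)" for x
  proof -
    have [measurable]: "S m \<in> borel_measurable (past m)" by (rule measurable_walk) simp
    note [measurable] = A balanced_past[OF n(2)] measurable_lyap
    show ?thesis unfolding g_def h_def by measurable
  qed
  have g01: "0 \<le> g \<omega> x" "g \<omega> x \<le> 1" for \<omega> x
    using h01[of \<omega>] lyap_pos[of "S m \<omega> + x"] lyap_le_1[of "S m \<omega> + x"]
    by (auto simp: g_def intro: mult_le_one)
  have g_bound: "\<bar>g \<omega> x\<bar> \<le> 1" for \<omega> x using g01[of \<omega> x] by simp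
  note next_step = expectation_next_step[OF m g_meas g_bound, simplified]
  have le: "step_mean p (\<lambda>k. \<sigma> k \<omega>) m (g \<omega>)
      \<le> indicator A \<omega> * (stopped_lyap n m \<omega> - stopped_lyap n m \<omega> ^ 5 / 200)"
    and mean01: "0 \<le> step_mean p (\<lambda>k. \<sigma> k \<omega>) m (g \<omega>)" "step_mean p (\<lambda>k. \<sigma> k \<omega>) m (g \<omega>) \<le> 1"
    if w: "\<omega> \<in> space M" for \<omega>
  proof -
    interpret step_history p "\<lambda>k. \<sigma> k \<omega>" m by (rule step_history[OF p w m])
    show "0 \<le> step_mean p (\<lambda>k. \<sigma> k \<omega>) m (g \<omega>)" "step_mean p (\<lambda>k. \<sigma> k \<omega>) m (g \<omega>) \<le> 1"
      using step_mean_mono[of "\<lambda>x. 0" "g \<omega>"] step_mean_mono[of "g \<omega>" "\<lambda>x. 1"] g01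
      by (simp_all add: step_mean_const)
    have eq: "step_mean p (\<lambda>k. \<sigma> k \<omega>) m (g \<omega>)
        = h \<omega> * step_mean p (\<lambda>k. \<sigma> k \<omega>) m (\<lambda>x. lyap (S m \<omega> + x))"
      unfolding g_def by (rule step_mean_cmult)
    show "step_mean p (\<lambda>k. \<sigma> k \<omega>) m (g \<omega>)
        \<le> indicator A \<omega> * (stopped_lyap n m \<omega> - stopped_lyap n m \<omega> ^ 5 / 200)"
    proof (cases "\<omega> \<in> balanced n m")
      case True
      then have "(\<Sum>k = 1..m. (\<sigma> k \<omega> $ i)\<^sup>2) \<le> 3 / 8 * m" for i
        using n by (auto simp: balanced_def axis_steps_def)
      from step_mean_lyap_le[OF d this] show ?thesis
        unfolding eq using True w by (auto simp: h_def stopped_lyap_def walk_eq_sum indicator_def)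
    next
      case False
      then show ?thesis unfolding eq by (simp add: h_def stopped_lyap_def)
    qed
  qed
  have meas [measurable]: "stopped_lyap n k \<in> borel_measurable M" if "n \<le> k" for k
    using measurable_stopped_lyap[OF that] by (rule measurable_from_history)
  have [measurable]: "A \<in> events" by (rule past_event[OF A])
  have g_next: "(\<lambda>\<omega>. g \<omega> (\<sigma> (Suc m) \<omega>)) \<in> borel_measurable M"
    using next_step(2) by (rule measurable_from_history)
  have mean_meas: "(\<lambda>\<omega>. step_mean p (\<lambda>k. \<sigma> k \<omega>) m (g \<omega>)) \<in> borel_measurable M"
    using next_step(3) by (rule measurable_from_history)
  have "expectation (\<lambda>\<omega>. indicator A \<omega> * stopped_lyap n (Suc m) \<omega>) \<le> expectation (\<lambda>\<omega>. g \<omega> (\<sigma> (Suc m) \<omega>))"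
  proof (rule integral_mono)
    show "integrable M (\<lambda>\<omega>. indicator A \<omega> * stopped_lyap n (Suc m) \<omega>)"
      using meas[of "Suc m"] n stopped_lyap_bounds[of n "Suc m"]
      by (intro integrable_bounded[of _ 1]) (auto simp: indicator_def)
    show "integrable M (\<lambda>\<omega>. g \<omega> (\<sigma> (Suc m) \<omega>))"
      using g_next g_bound by (rule integrable_bounded)
    show "indicator A \<omega> * stopped_lyap n (Suc m) \<omega> \<le> g \<omega> (\<sigma> (Suc m) \<omega>)" if "\<omega> \<in> space M" for \<omega>
    proof -
      have "balanced n (Suc m) \<subseteq> balanced n m" by (auto simp: balanced_def)
      then show ?thesis using lyap_pos[of "S m \<omega> + \<sigma> (Suc m) \<omega>"] that
        by (auto simp: stopped_lyap_def g_def h_def walk_Suc indicator_def)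
    qed
  qed
  also have "\<dots> = expectation (\<lambda>\<omega>. step_mean p (\<lambda>k. \<sigma> k \<omega>) m (g \<omega>))" by (rule next_step(1))
  also have "\<dots> \<le> expectation (\<lambda>\<omega>. indicator A \<omega> * (stopped_lyap n m \<omega> - stopped_lyap n m \<omega> ^ 5 / 200))"
  proof (rule integral_mono[OF _ _ le])
    show "integrable M (\<lambda>\<omega>. step_mean p (\<lambda>k. \<sigma> k \<omega>) m (g \<omega>))"
      using mean_meas mean01 by (intro integrable_bounded[of _ 1]) auto
    show "integrable M (\<lambda>\<omega>. indicator A \<omega> * (stopped_lyap n m \<omega> - stopped_lyap n m \<omega> ^ 5 / 200))"
    proof (rule integrable_bounded[of _ 1])
      fix \<omega>
      have "0 \<le> stopped_lyap n m \<omega> ^ 5"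
        using stopped_lyap_bounds(1)[of n m \<omega>] by (rule zero_le_power)
      moreover have "stopped_lyap n m \<omega> ^ 5 \<le> stopped_lyap n m \<omega>"
        using stopped_lyap_bounds[of n m \<omega>] power_decreasing[of 1 5 "stopped_lyap n m \<omega>"] by auto
      ultimately have "\<bar>stopped_lyap n m \<omega> - stopped_lyap n m \<omega> ^ 5 / 200\<bar> \<le> 1"
        using stopped_lyap_bounds[of n m \<omega>] by linarith
      then show "\<bar>indicator A \<omega> * (stopped_lyap n m \<omega> - stopped_lyap n m \<omega> ^ 5 / 200)\<bar> \<le> 1"
        by (simp add: indicator_def)
    qed (use meas[OF n(2)] in measurable)
  qed
  finally show ?thesis .
qed

lemma prob_stopped_lyap_ge:
  assumes d: "CARD('d) \<ge> 3" and p: "p \<ge> 1 / (2 * real CARD('d))"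
    and n: "n \<ge> 1" "n \<le> m" and l: "l > 0"
  shows "prob {\<omega> \<in> space M. \<exists>k\<ge>m. l \<le> stopped_lyap n k \<omega>} \<le> expectation (stopped_lyap n m) / l"
    and "expectation (stopped_lyap n m) ^ 4 * real (m - n) \<le> 200"
proof -
  have meas: "stopped_lyap n k \<in> borel_measurable M" if "n \<le> k" for k
    using measurable_stopped_lyap[OF that] by (rule measurable_from_history)
  have int: "integrable M (stopped_lyap n k)" if "n \<le> k" for k
    using meas[OF that] stopped_lyap_bounds by (intro integrable_bounded[of _ 1]) auto
  have int5: "integrable M (\<lambda>\<omega>. stopped_lyap n k \<omega> ^ 5)" if "n \<le> k" for k
    using meas[OF that] stopped_lyap_bounds
    by (intro integrable_bounded[of _ 1]) (auto intro: power_le_one)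
  have int_A: "integrable M (\<lambda>\<omega>. indicator A \<omega> * h \<omega>)" if "A \<in> events" "integrable M h" for A and h :: "'w \<Rightarrow> real"
    using integrable_mult_indicator[OF that] by simp
  show "prob {\<omega> \<in> space M. \<exists>k\<ge>m. l \<le> stopped_lyap n k \<omega>} \<le> expectation (stopped_lyap n m) / l"
  proof (rule supermartingale_maximal_inequality[where F = past])
    show "subalgebra M (past k)" for k by (rule subalgebra_history)
    show "sets (past k) \<subseteq> sets (past (Suc k))" for k by (rule sets_history_mono) auto
    fix k A assume k: "m \<le> k" and A: "A \<in> sets (past k)"
    have nk: "n \<le> k" using n k by simp
    have "expectation (\<lambda>\<omega>. indicator A \<omega> * stopped_lyap n (Suc k) \<omega>)
        \<le> expectation (\<lambda>\<omega>. indicator A \<omega> * (stopped_lyap n k \<omega> - stopped_lyap n k \<omega> ^ 5 / 200))"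
      by (rule stopped_lyap_step[OF d p n(1) nk A])
    also have "\<dots> \<le> expectation (\<lambda>\<omega>. indicator A \<omega> * stopped_lyap n k \<omega>)"
      using int[OF nk] int5[OF nk] past_event[OF A] stopped_lyap_bounds
      by (intro integral_mono int_A mult_left_mono) auto
    finally show "expectation (\<lambda>\<omega>. indicator A \<omega> * stopped_lyap n (Suc k) \<omega>)
        \<le> expectation (\<lambda>\<omega>. indicator A \<omega> * stopped_lyap n k \<omega>)" .
  qed (use n l int measurable_stopped_lyap stopped_lyap_bounds in auto)
  have "1 / 200 * expectation (stopped_lyap n m) ^ 4 * real (m - n) \<le> 1"
  proof (rule fifth_power_decay[where x = "\<lambda>m. expectation (stopped_lyap n m)"])
    show "0 \<le> expectation (stopped_lyap n k)" for k
      using stopped_lyap_bounds by (simp add: integral_nonneg_AE)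
    fix k assume k: "n \<le> k"
    have "expectation (\<lambda>\<omega>. indicator (space M) \<omega> * stopped_lyap n (Suc k) \<omega>)
        \<le> expectation (\<lambda>\<omega>. indicator (space M) \<omega> * (stopped_lyap n k \<omega> - stopped_lyap n k \<omega> ^ 5 / 200))"
      by (rule stopped_lyap_step[OF d p n(1) k]) (use sets.top[of "past k"] in simp)
    then have "expectation (stopped_lyap n (Suc k))
        \<le> expectation (\<lambda>\<omega>. stopped_lyap n k \<omega> - stopped_lyap n k \<omega> ^ 5 / 200)"
      by (simp cong: Bochner_Integration.integral_cong)
    also have "\<dots> = expectation (stopped_lyap n k) - expectation (\<lambda>\<omega>. stopped_lyap n k \<omega> ^ 5) / 200"
      using int[OF k] int5[OF k] by simp
    also have "\<dots> \<le> expectation (stopped_lyap n k) - 1 / 200 * expectation (stopped_lyap n k) ^ 5"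
      using expectation_power_5_ge[OF meas[OF k]] stopped_lyap_bounds by simp
    finally show "expectation (stopped_lyap n (Suc k))
        \<le> expectation (stopped_lyap n k) - 1 / 200 * expectation (stopped_lyap n k) ^ 5" .
  qed (use n in auto)
  then show "expectation (stopped_lyap n m) ^ 4 * real (m - n) \<le> 200" by simp
qed

end

section \<open>Rate of escape\<close>

text \<open>For large \<open>j\<close>, an upper bound of \<open>|x|\<^sup>2 + offset\<close> for the points \<open>x\<close> closer to the origin than the
  claim allows at a time \<open>n\<close> with \<open>2 ^ j \<le> n < 2 ^ Suc j\<close>: one factor \<open>2\<close> comes from \<open>n \<le> 2 * 2 ^ j\<close>, the other
  makes room for the offset.\<close>
definition visit_level :: "nat \<Rightarrow> real" where
  "visit_level j = 4 * 2 ^ j * (j * ln 2) powr (-6)"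

lemma visit_level_eventually_large: "\<forall>\<^sub>F j in sequentially. offset \<le> visit_level j / 2"
  unfolding visit_level_def offset_def by real_asymp

lemma small_norm_imp_le_visit_level:
  fixes x :: "'a::real_normed_vector"
  assumes j: "j \<ge> 1" "2 ^ j \<le> n" "n < 2 ^ Suc j" and large: "offset \<le> visit_level j / 2"
    and small: "norm x < real n powr (1 / 2) * ln (real n) powr (- 3)"
  shows "(norm x)\<^sup>2 + offset \<le> visit_level j"
proof -
  define l where "l = real j * ln 2"
  have l: "l > 0" using j by (simp add: l_def)
  have nj: "2 ^ j \<le> real n" "real n \<le> 2 * 2 ^ j" using j(2,3)
    by (metis of_nat_le_iff of_nat_numeral of_nat_power, metis less_imp_le of_nat_le_iff of_nat_numeral of_nat_power power_Suc)
  have n0: "real n > 0" using nj(1) by (smt (verit) zero_less_power)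
  have "l = ln (2 ^ j)" by (simp add: l_def ln_realpow)
  also have "\<dots> \<le> ln n" using nj n0 by (subst ln_le_cancel_iff) auto
  finally have ln: "l \<le> ln n" .
  have "(norm x)\<^sup>2 \<le> (real n powr (1 / 2) * ln (real n) powr (- 3))\<^sup>2"
    using small by (intro power_mono) auto
  also have "\<dots> = real n * ln (real n) powr (-6)"
  proof -
    have "(ln (real n) powr (- 3))\<^sup>2 = ln (real n) powr (-6)"
      using powr_add[of "ln (real n)" "-3" "-3"] by (simp add: power2_eq_square)
    moreover have "(real n powr (1 / 2))\<^sup>2 = real n"
      using powr_add[of "real n" "1/2" "1/2"] n0 by (simp add: power2_eq_square)
    ultimately show ?thesis by (simp add: power_mult_distrib)
  qed
  also have "\<dots> \<le> (2 * 2 ^ j) * l powr (-6)"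
    using nj ln l by (intro mult_mono powr_mono2') auto
  also have "\<dots> = visit_level j / 2" by (simp add: visit_level_def l_def)
  finally show ?thesis using large by simp
qed

lemma finite_small_norm_if_lyap_small:
  fixes s :: "nat \<Rightarrow> 'a::real_normed_vector"
  assumes "\<forall>\<^sub>F j in sequentially. \<forall>m\<ge>2 ^ j. lyap (s m) < visit_level j powr (-1/4)"
  shows "finite {n. n > 1 \<and> \<not> norm (s n) \<ge> real n powr (1 / 2) * ln (real n) powr (- 3)}"
proof -
  have "\<forall>\<^sub>F j in sequentially. j \<ge> 1 \<and> offset \<le> visit_level j / 2 \<and> (\<forall>m\<ge>2 ^ j. lyap (s m) < visit_level j powr (-1/4))"
    using assms visit_level_eventually_large eventually_ge_at_top[of 1] by eventually_elim auto
  then obtain J where J: "\<And>j. j \<ge> J \<Longrightarrow> j \<ge> 1 \<and> offset \<le> visit_level j / 2 \<and>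
      (\<forall>m\<ge>2 ^ j. lyap (s m) < visit_level j powr (-1/4))"
    by (auto simp: eventually_sequentially)
  have "{n. n > 1 \<and> \<not> norm (s n) \<ge> real n powr (1 / 2) * ln (real n) powr (- 3)} \<subseteq> {..<2 ^ J}"
  proof (rule subsetI, rule ccontr)
    fix n assume "n \<in> {n. n > 1 \<and> \<not> norm (s n) \<ge> real n powr (1 / 2) * ln (real n) powr (- 3)}"
      and "n \<notin> {..<2 ^ J}"
    then have n: "n > 1" "norm (s n) < real n powr (1 / 2) * ln (real n) powr (- 3)" "2 ^ J \<le> n" by auto
    obtain j where j: "2 ^ j \<le> n" "n < 2 ^ Suc j"
      using ex_power_ivl1[of 2 n] n(1) by auto
    have "(2::nat) ^ J < 2 ^ Suc j" using n(3) j(2) by linarith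
    then have "J < Suc j" by (rule power_less_imp_less_exp[rotated]) simp
    then have "J \<le> j" by simp
    note Jj = J[OF this]
    have "visit_level j powr (-1/4) \<le> lyap (s n)"
      using Jj j n(2) by (intro lyap_ge small_norm_imp_le_visit_level[of j n]) auto
    then show False using Jj j(1) by force
  qed
  then show ?thesis by (rule finite_subset) simp
qed

context merw
begin

text \<open>For large \<open>j\<close> the mean at time \<open>2 ^ j\<close> is at most \<open>(400 / 2 ^ j) powr (1/4)\<close>, so by the maximal
  inequality the level \<open>visit_level j powr (-1/4)\<close> is reached from then on with
  probability at most of order \<open>j powr (-3/2)\<close>.\<close>
lemma AE_stopped_lyap_less:
  assumes d: "CARD('d) \<ge> 3" and p: "p \<ge> 1 / (2 * real CARD('d))" and n: "n \<ge> 1"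
  shows "AE \<omega> in M. \<forall>\<^sub>F j in sequentially. \<forall>m\<ge>(2::nat) ^ j. stopped_lyap n m \<omega> < visit_level j powr (-1/4)"
proof -
  define B where "B j = {\<omega> \<in> space M. n \<le> 2 ^ j \<and> (\<exists>m\<ge>2 ^ j. visit_level j powr (-1/4) \<le> stopped_lyap n m \<omega>)}"
    for j :: nat
  have B_event: "B j \<in> events" for j
  proof (cases "n \<le> 2 ^ j")
    case True
    have "B j = (\<Union>m\<in>{(2::nat) ^ j..}. {\<omega> \<in> space M. visit_level j powr (-1/4) \<le> stopped_lyap n m \<omega>})"
      using True by (auto simp: B_def)
    also have "\<dots> \<in> events"
    proof (rule sets.countable_UN'')
      fix m :: nat assume "m \<in> {2 ^ j..}"
      then have "n \<le> m" using True by auto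
      then have [measurable]: "stopped_lyap n m \<in> borel_measurable M"
        using measurable_stopped_lyap measurable_from_history by blast
      show "{\<omega> \<in> space M. visit_level j powr (-1/4) \<le> stopped_lyap n m \<omega>} \<in> events" by measurable
    qed simp
    finally show ?thesis .
  qed (simp add: B_def)
  have bound: "prob (B j) \<le> 1600 powr (1/4) * (j * ln 2) powr (-3/2)" if j: "j \<ge> 1" "2 * n \<le> 2 ^ j" for j
  proof -
    define x where "x = expectation (stopped_lyap n (2 ^ j))"
    have x0: "x \<ge> 0" unfolding x_def using stopped_lyap_bounds by (simp add: integral_nonneg_AE)
    have nj: "n \<le> 2 ^ j" using j by simp
    have s: "visit_level j > 0" using j by (simp add: visit_level_def)
    have "real (2 * n) \<le> real (2 ^ j)" using j(2) by (rule of_nat_mono)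
    then have "real (2 ^ j - n) \<ge> 2 ^ j / 2" using nj by (simp add: of_nat_diff)
    then have "x ^ 4 * (2 ^ j / 2) \<le> x ^ 4 * real (2 ^ j - n)" using x0 by (intro mult_left_mono) auto
    also have "\<dots> \<le> 200" unfolding x_def by (rule prob_stopped_lyap_ge(2)[OF d p n nj zero_less_one])
    finally have "x ^ 4 \<le> 400 / 2 ^ j" by (simp add: field_simps)
    then have "(x ^ 4) powr (1/4) \<le> (400 / 2 ^ j) powr (1/4)" using x0 by (intro powr_mono2) auto
    moreover have "(x ^ 4) powr (1/4) = x"
    proof (cases "x = 0")
      case False
      then have "x > 0" using x0 by simp
      then have "(x ^ 4) powr (1/4) = (x powr real 4) powr (1/4)" by (simp only: powr_realpow)
      also have "\<dots> = x" unfolding powr_powr using \<open>x > 0\<close> by simp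
      finally show ?thesis .
    qed simp
    ultimately have x: "x \<le> (400 / 2 ^ j) powr (1/4)" by simp
    have "prob (B j) \<le> x / visit_level j powr (-1/4)"
      unfolding x_def B_def using prob_stopped_lyap_ge(1)[OF d p n nj, of "visit_level j powr (-1/4)"] s nj by simp
    also have "\<dots> = x * visit_level j powr (1/4)"
      using powr_minus_divide[of "visit_level j" "1/4"] by simp
    also have "\<dots> \<le> (400 / 2 ^ j) powr (1/4) * visit_level j powr (1/4)" using x by (intro mult_right_mono) auto
    also have "\<dots> = (400 / 2 ^ j * visit_level j) powr (1/4)" by (rule powr_mult[symmetric])
    also have "400 / 2 ^ j * visit_level j = 1600 * (j * ln 2) powr (-6)" by (simp add: visit_level_def)
    also have "(1600 * (j * ln 2) powr (-6)) powr (1/4) = 1600 powr (1/4) * ((j * ln 2) powr (-6)) powr (1/4)"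
      by (rule powr_mult)
    also have "((j * ln 2) powr (-6)) powr (1/4) = (j * ln 2) powr (-3/2)"
      by (simp only: powr_powr) simp
    finally show ?thesis .
  qed
  have "summable (\<lambda>j. (1600 powr (1/4) * ln 2 powr (-3/2)) * real j powr (-3/2))"
    by (intro summable_mult) (simp add: summable_real_powr_iff)
  then have sum: "summable (\<lambda>j. 1600 powr (1/4) * (j * ln 2) powr (-3/2))"
    by (simp add: powr_mult mult_ac)
  have ev: "\<forall>\<^sub>F j in sequentially. 2 * n \<le> (2::nat) ^ j"
  proof (rule eventually_sequentiallyI)
    fix j assume "2 * n \<le> j"
    then show "2 * n \<le> 2 ^ j" using less_exp[of j] by linarith
  qed
  have "\<forall>\<^sub>F j in sequentially. norm (prob (B j)) \<le> 1600 powr (1/4) * (j * ln 2) powr (-3/2)"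
    using ev eventually_ge_at_top[of 1] by eventually_elim (use bound in auto)
  then have "summable (\<lambda>j. prob (B j))" by (rule summable_comparison_test_ev[OF _ sum])
  then have "AE \<omega> in M. \<forall>\<^sub>F j in sequentially. \<omega> \<in> space M - B j"
    using B_event by (intro borel_cantelli_AE1) (auto simp: emeasure_eq_measure)
  then show ?thesis
  proof eventually_elim
    case (elim \<omega>)
    from this ev show ?case
    proof eventually_elim
      case (elim j)
      then have "\<not> visit_level j powr (-1/4) \<le> stopped_lyap n m \<omega>" if "2 ^ j \<le> m" for m
        using that unfolding B_def by auto
      then show ?case by (simp add: not_le)
    qed
  qed
qed

lemma AE_eventually_balanced:
  assumes d: "CARD('d) \<ge> 3" and p: "p \<ge> 1 / (2 * real CARD('d))" "p < 1"
  shows "AE \<omega> in M. \<exists>n\<ge>1. \<forall>m\<ge>n. \<omega> \<in> balanced n m"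
proof -
  have [measurable]: "axis_steps i m \<in> borel_measurable M" for i m
    using measurable_axis_steps[of m m i "m - 1", THEN measurable_from_history] by simp
  have U: "unbalanced n \<in> events" for n
    unfolding unbalanced_def by measurable
  define Z where "Z = (\<Inter>n. unbalanced (Suc n))"
  have Z: "Z \<in> events" using U unfolding Z_def by auto
  have "prob Z \<le> 0"
  proof (rule LIMSEQ_le_const)
    show "(\<lambda>n. prob (unbalanced (Suc n))) \<longlonglongrightarrow> 0"
      using prob_unbalanced_tendsto_0[OF d p] by (rule LIMSEQ_Suc)
    show "\<exists>N. \<forall>n\<ge>N. prob Z \<le> prob (unbalanced (Suc n))"
      using U by (intro exI allI impI finite_measure_mono) (auto simp: Z_def)
  qed
  then have "AE \<omega> in M. \<omega> \<notin> Z"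
    using Z by (intro AE_not_in) (auto simp: null_sets_def emeasure_eq_measure antisym)
  with AE_space show ?thesis
  proof eventually_elim
    case (elim \<omega>)
    then obtain n where "\<omega> \<notin> unbalanced (Suc n)" by (auto simp: Z_def)
    then have "\<omega> \<in> balanced (Suc n) m" for m
      using elim by (auto simp: unbalanced_def balanced_def not_less)
    then show ?case by (intro exI[of _ "Suc n"]) auto
  qed
qed

text \<open>For \<open>p = 1\<close> the averaging operator only sees the past steps, which are all equal by induction.\<close>
lemma AE_all_steps_eq:
  assumes "p = 1"
  shows "AE \<omega> in M. \<forall>n\<ge>1. \<sigma> n \<omega> = axis i\<^sub>1 1"
proof -
  have "AE \<omega> in M. \<sigma> n \<omega> = axis i\<^sub>1 1" if "n \<ge> 1" for n
    using that
  proof (induction n rule: less_induct)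
    case (less n)
    show ?case
    proof (cases "n = 1")
      case True
      then show ?thesis using first_step by auto
    next
      case False
      with less.prems obtain k where k: "n = Suc k" "k \<ge> 1" by (cases n) auto
      define g :: "'w \<Rightarrow> real ^ 'd \<Rightarrow> real" where "g \<omega> x = (if x = axis i\<^sub>1 1 then 0 else 1)" for \<omega> x
      have next_step: "expectation (\<lambda>\<omega>. g \<omega> (\<sigma> n \<omega>)) = expectation (\<lambda>\<omega>. step_mean p (\<lambda>k. \<sigma> k \<omega>) k (g \<omega>))"
        "(\<lambda>\<omega>. g \<omega> (\<sigma> n \<omega>)) \<in> borel_measurable (past n)"
        unfolding k(1)
        by (rule expectation_next_step[OF k(2), of g 1]; simp add: g_def)+
      have "AE \<omega> in M. \<forall>j\<in>{1..k}. \<sigma> j \<omega> = axis i\<^sub>1 1"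
        using less.IH k by (subst AE_ball_countable) auto
      then have "AE \<omega> in M. step_mean p (\<lambda>k. \<sigma> k \<omega>) k (g \<omega>) = 0"
        by eventually_elim (simp add: step_mean_def g_def assms)
      then have "expectation (\<lambda>\<omega>. step_mean p (\<lambda>k. \<sigma> k \<omega>) k (g \<omega>)) = 0"
        by (rule integral_eq_zero_AE)
      moreover have "integrable M (\<lambda>\<omega>. g \<omega> (\<sigma> n \<omega>))"
        using next_step(2)[THEN measurable_from_history]
        by (rule integrable_bounded[of _ 1]) (simp add: g_def)
      ultimately have "AE \<omega> in M. g \<omega> (\<sigma> n \<omega>) = 0"
        using next_step(1) by (subst integral_nonneg_eq_0_iff_AE[symmetric]) (auto simp: g_def)
      then show ?thesis by eventually_elim (simp add: g_def split: if_splits)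
    qed
  qed
  then show ?thesis by (subst AE_all_countable) auto
qed

end

theorem proposition1p2:
  fixes M :: "'w measure"
    and i\<^sub>1 :: "'d::finite"
    and p :: real
    and \<sigma> S :: "nat \<Rightarrow> 'w \<Rightarrow> real ^ 'd"
    and N :: "nat \<Rightarrow> 'w \<Rightarrow> nat"
  assumes "CARD('d) \<ge> 3"
    and "p \<in> {1 / (2 * real CARD('d))..1}"
    and "merw M i\<^sub>1 p \<sigma> N S"
  shows "AE \<omega> in M. finite {n. n > 1 \<and>
           \<not> norm (S n \<omega>) \<ge> real n powr (1 / 2) * ln (real n) powr (- 3)}"
proof -
  interpret merw M i\<^sub>1 p \<sigma> N S by (rule assms)
  have p: "p \<ge> 1 / (2 * real CARD('d))" using assms(2) by simp
  consider "p = 1" | "p < 1" using assms(2) by fastforce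
  then show ?thesis
  proof cases
    case 1
    show ?thesis
      using AE_all_steps_eq[OF 1] AE_space
    proof eventually_elim
      case (elim \<omega>)
      have "S n \<omega> = real n *\<^sub>R axis i\<^sub>1 1" for n
        using elim by (simp add: walk_eq_sum sum_constant_scaleR del: sum_constant)
      then have norm: "norm (S n \<omega>) = n" for n by simp
      have "\<forall>\<^sub>F n in sequentially. real n powr (1 / 2) * ln (real n) powr (- 3) \<le> real n"
        by real_asymp
      then obtain n0 where "\<And>n. n \<ge> n0 \<Longrightarrow> real n powr (1 / 2) * ln (real n) powr (- 3) \<le> real n"
        by (auto simp: eventually_sequentially)
      then have "{n. n > 1 \<and> \<not> norm (S n \<omega>) \<ge> real n powr (1 / 2) * ln (real n) powr (- 3)} \<subseteq> {..<n0}"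
        unfolding norm by (auto simp: not_less[symmetric])
      then show ?case by (rule finite_subset) simp
    qed
  next
    case 2
    \<comment> \<open>The time from which on the axes are balanced is random, so the bound is needed for all
      starting times at once.\<close>
    have "AE \<omega> in M. \<forall>n. n \<ge> 1 \<longrightarrow>
        (\<forall>\<^sub>F j in sequentially. \<forall>m\<ge>2 ^ j. stopped_lyap n m \<omega> < visit_level j powr (-1/4))"
      using AE_stopped_lyap_less[OF assms(1) p] by (subst AE_all_countable) auto
    with AE_eventually_balanced[OF assms(1) p 2] show ?thesis
    proof eventually_elim
      case (elim \<omega>)
      then obtain n where n: "n \<ge> 1" "\<And>m. m \<ge> n \<Longrightarrow> \<omega> \<in> balanced n m" by auto
      have "\<forall>\<^sub>F j in sequentially. n \<le> 2 ^ j"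
      proof (rule eventually_sequentiallyI)
        fix j assume "n \<le> j"
        then show "n \<le> 2 ^ j" using less_exp[of j] by linarith
      qed
      moreover have "\<forall>\<^sub>F j in sequentially. \<forall>m\<ge>2 ^ j. stopped_lyap n m \<omega> < visit_level j powr (-1/4)"
        using elim n(1) by blast
      ultimately have "\<forall>\<^sub>F j in sequentially. \<forall>m\<ge>2 ^ j. lyap (S m \<omega>) < visit_level j powr (-1/4)"
      proof eventually_elim
        case (elim j)
        show ?case
        proof (intro allI impI)
          fix m :: nat assume m: "2 ^ j \<le> m"
          then have "\<omega> \<in> balanced n m" using elim n(2) by auto
          then show "lyap (S m \<omega>) < visit_level j powr (-1/4)"
            using elim m by (auto simp: stopped_lyap_def dest!: spec[of _ m])
        qed
      qed
      then show ?case by (rule finite_small_norm_if_lyap_small)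
    qed
  qed
qed

end
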